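(* Let $\sigma>0$ and let $\theta\in S^1e_++S^1e_-$ with $\theta\ne\pm1,\pm ij$. The inversion formula for $\mathcal{F}^\sigma_\theta$ is the bicomplex fractional Fourier transform with the parameter $\theta^*$. More explicitly, $$[\mathcal{F}^\sigma_\theta]^{-1}(\psi)(x)=\frac{(\sigma/\pi)^{1/2}}{\sqrt{1-(\theta^* )^2}}\int_{\mathbb{R}}\psi(y)\,e^{-\frac{\sigma}{1-(\theta^* )^2}(y-\theta^*x)^2}\,dy$$ for every $\psi\in L^{2,\sigma}_{\mathbb{T}}(\mathbb{R})$.
   Context: Bicomplex numbers: $\mathbb{T}=\{Z=z_1+jz_2:\ z_1,z_2\in\mathbb{C}\}$ is the commutative algebra in which $i^2=j^2=-1$, $ij=ji$ and $\mathbb{C}=\mathbb{R}+i\mathbb{R}$. Put $e_\pm=\frac{1\pm ij}{2}$; then $e_\pm^2=e_\pm$, $e_+e_-=0$, $e_++e_-=1$, $e_+-e_-=ij$. Every $Z=z_1+jz_2$ is uniquely $Z=\alpha e_++\beta e_-$ with $\alpha=z_1-iz_2$, $\beta=z_1+iz_2\in\mathbb{C}$; algebraic operations are componentwise in $(\alpha,\beta)$, $e^Z=e^\alpha e_++e^\beta e_-$, and $\sqrt{\alpha e_++\beta e_-}=\sqrt{\alpha}\,e_++\sqrt{\beta}\,e_-$ with principal square roots. Set $Z^*=\overline{\alpha}e_++\overline{\beta}e_-$. $S^1=\{\xi\in\mathbb{C}:|\xi|=1\}$, and $S^1e_++S^1e_-=\{\alpha e_++\beta e_-:\alpha,\beta\in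 S^1\}$. $L^{2,\sigma}_{\mathbb{T}}(\mathbb{R})$ is the space of (classes modulo a.e. equality of) functions $\varphi=\varphi^+e_++\varphi^-e_-:\mathbb{R}\to\mathbb{T}$ with $\varphi^\pm:\mathbb{R}\to\mathbb{C}$ square integrable for $e^{-\sigma x^2}dx$, with inner product $\langle\varphi,\psi\rangle=\left(\frac{\sigma}{\pi}\right)^{1/2}\int_{\mathbb{R}}\varphi(x)\psi(x)^*e^{-\sigma x^2}dx$ and norm $\|\varphi\|^2=\frac{a+b}{2}$ where $\langle\varphi,\varphi\rangle=a\,e_++b\,e_-$. The bicomplex fractional Fourier transform with parameter $\theta$ is $$\mathcal{F}^\sigma_\theta\psi(y)=\frac{(\sigma/\pi)^{1/2}}{\sqrt{1-\theta^2}}\int_{\mathbb{R}}\psi(x)\,e^{-\frac{\sigma}{1-\theta^2}(x-\theta y)^2}\,dx,\qquad \psi\in L^{2,\sigma}_{\mathbb{T}}(\mathbb{R}).$$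
   Formalization: It is also assumed that 1−θ² is invertible: for θ = e_+ + i e_-, allowed above, 1−θ² is a zero divisor and the formula is undefined. Integrals over R are norm limits of integrals over [−R,R], equal a.e. to the ordinary integral where it converges absolutely. *)

theory Defs
  imports "HOL-Analysis.Analysis"
begin

section \<open>Bicomplex numbers\<close>

text \<open>\<open>Bicomplex z1 z2\<close> stands for \<open>z1 + j z2\<close>.\<close>

datatype bicomplex = Bicomplex (bc1: complex) (bc2: complex)

lemma bicomplex_eq_iff: "Z = W \<longleftrightarrow> bc1 Z = bc1 W \<and> bc2 Z = bc2 W"
  by (cases Z; cases W) simp

instantiation bicomplex :: comm_ring_1
begin

definition "0 = Bicomplex 0 0"
definition "1 = Bicomplex 1 0"
definition "Z + W = Bicomplex (bc1 Z + bc1 W) (bc2 Z + bc2 W)"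
definition "- Z = Bicomplex (- bc1 Z) (- bc2 Z)"
definition "Z - W = Bicomplex (bc1 Z - bc1 W) (bc2 Z - bc2 W)"
definition "Z * W = Bicomplex (bc1 Z * bc1 W - bc2 Z * bc2 W) (bc1 Z * bc2 W + bc2 Z * bc1 W)"

instance
  by standard
    (simp_all add: zero_bicomplex_def one_bicomplex_def plus_bicomplex_def uminus_bicomplex_def
      minus_bicomplex_def times_bicomplex_def algebra_simps)

end

lemma bc_simps [simp]:
  "bc1 0 = 0" "bc2 0 = 0" "bc1 1 = 1" "bc2 1 = 0"
  "bc1 (Z + W) = bc1 Z + bc1 W" "bc2 (Z + W) = bc2 Z + bc2 W"
  "bc1 (- Z) = - bc1 Z" "bc2 (- Z) = - bc2 Z"
  "bc1 (Z - W) = bc1 Z - bc1 W" "bc2 (Z - W) = bc2 Z - bc2 W"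
  "bc1 (Z * W) = bc1 Z * bc1 W - bc2 Z * bc2 W"
  "bc2 (Z * W) = bc1 Z * bc2 W + bc2 Z * bc1 W"
  by (simp_all add: zero_bicomplex_def one_bicomplex_def plus_bicomplex_def uminus_bicomplex_def
      minus_bicomplex_def times_bicomplex_def)

instantiation bicomplex :: real_algebra_1
begin

definition "r *\<^sub>R Z = Bicomplex (r *\<^sub>R bc1 Z) (r *\<^sub>R bc2 Z)"

instance
  by standard (simp_all add: scaleR_bicomplex_def bicomplex_eq_iff algebra_simps)

end

lemma bc_scaleR [simp]: "bc1 (r *\<^sub>R Z) = r *\<^sub>R bc1 Z" "bc2 (r *\<^sub>R Z) = r *\<^sub>R bc2 Z"
  by (simp_all add: scaleR_bicomplex_def)

text \<open>The Euclidean structure of \<open>\<real>\<^sup>4\<close>, which makes the Bochner integral of bicomplex-valued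
  functions available. This norm is not submultiplicative, so there is no instance of the class
  of normed algebras.\<close>

instantiation bicomplex :: real_inner
begin

definition "inner Z W = inner (bc1 Z) (bc1 W) + inner (bc2 Z) (bc2 W)"
definition "norm (Z :: bicomplex) = sqrt (inner Z Z)"
definition "sgn (Z :: bicomplex) = Z /\<^sub>R norm Z"
definition "dist (Z :: bicomplex) W = norm (Z - W)"
definition [code del]: "(uniformity :: (bicomplex \<times> bicomplex) filter) =
  (INF e\<in>{0<..}. principal {(x, y). dist x y < e})"
definition [code del]: "open (U :: bicomplex set) \<longleftrightarrow>
  (\<forall>x\<in>U. eventually (\<lambda>(x', y). x' = x \<longrightarrow> y \<in> U) uniformity)"

instance
proof
  fix Z W V :: bicomplex and r :: real
  show "inner Z W = inner W Z"
    by (simp add: inner_bicomplex_def inner_commute)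
  show "inner (Z + W) V = inner Z V + inner W V"
    by (simp add: inner_bicomplex_def inner_add_left)
  show "inner (r *\<^sub>R Z) W = r * inner Z W"
    by (simp add: inner_bicomplex_def distrib_left)
  show "0 \<le> inner Z Z"
    by (simp add: inner_bicomplex_def)
  show "inner Z Z = 0 \<longleftrightarrow> Z = 0"
    by (simp add: inner_bicomplex_def add_nonneg_eq_0_iff bicomplex_eq_iff)
qed (rule norm_bicomplex_def sgn_bicomplex_def dist_bicomplex_def
    uniformity_bicomplex_def open_bicomplex_def)+

end

instantiation bicomplex :: euclidean_space
begin

definition "Basis = {Bicomplex 1 0, Bicomplex \<i> 0, Bicomplex 0 1, Bicomplex 0 \<i>}"

instance
proof
  show "(Basis :: bicomplex set) \<noteq> {}" "finite (Basis :: bicomplex set)"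
    by (simp_all add: Basis_bicomplex_def)
  fix u v :: bicomplex
  show "inner u v = (if u = v then 1 else 0)" if "u \<in> Basis" "v \<in> Basis"
    using that unfolding Basis_bicomplex_def
    by (elim insertE emptyE; simp add: inner_bicomplex_def)
  show "(\<forall>b\<in>Basis. inner u b = 0) \<longleftrightarrow> u = 0"
    by (cases u) (simp add: Basis_bicomplex_def inner_bicomplex_def inner_complex_def
        zero_bicomplex_def complex_eq_iff)
qed

end

definition bc_of_complex :: "complex \<Rightarrow> bicomplex" where
  "bc_of_complex z = Bicomplex z 0"

definition bc_i :: bicomplex where "bc_i = bc_of_complex \<i>"

definition bc_j :: bicomplex where "bc_j = Bicomplex 0 1"

lemma bc_units: "bc_i * bc_i = - 1" "bc_j * bc_j = - 1"
  and bc_decompose: "Z = bc_of_complex (bc1 Z) + bc_j * bc_of_complex (bc2 Z)"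
  by (simp_all add: bc_i_def bc_j_def bc_of_complex_def bicomplex_eq_iff)

subsection \<open>Idempotent decomposition\<close>

definition e_plus :: bicomplex where "e_plus = (1/2) *\<^sub>R (1 + bc_i * bc_j)"

definition e_minus :: bicomplex where "e_minus = (1/2) *\<^sub>R (1 - bc_i * bc_j)"

definition idem :: "complex \<Rightarrow> complex \<Rightarrow> bicomplex" where
  "idem \<alpha> \<beta> = bc_of_complex \<alpha> * e_plus + bc_of_complex \<beta> * e_minus"

definition cplus :: "bicomplex \<Rightarrow> complex" where "cplus Z = bc1 Z - \<i> * bc2 Z"

definition cminus :: "bicomplex \<Rightarrow> complex" where "cminus Z = bc1 Z + \<i> * bc2 Z"

lemma idem_units: "e_plus * e_plus = e_plus" "e_minus * e_minus = e_minus"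
  "e_plus * e_minus = 0" "e_plus + e_minus = 1" "e_plus - e_minus = bc_i * bc_j"
  by (simp_all add: e_plus_def e_minus_def bc_i_def bc_j_def bc_of_complex_def bicomplex_eq_iff
      complex_eq_iff)

lemma idem_collapse [simp]: "idem (cplus Z) (cminus Z) = Z"
  by (auto simp add: idem_def cplus_def cminus_def e_plus_def e_minus_def bc_i_def bc_j_def
      bc_of_complex_def bicomplex_eq_iff complex_eq_iff field_simps)

lemma cplus_idem [simp]: "cplus (idem \<alpha> \<beta>) = \<alpha>"
  and cminus_idem [simp]: "cminus (idem \<alpha> \<beta>) = \<beta>"
  by (simp_all add: idem_def cplus_def cminus_def e_plus_def e_minus_def bc_i_def bc_j_def
      bc_of_complex_def complex_eq_iff)

lemma cplus_cminus_ring [simp]: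
  "cplus (Z + W) = cplus Z + cplus W" "cminus (Z + W) = cminus Z + cminus W"
  "cplus (Z * W) = cplus Z * cplus W" "cminus (Z * W) = cminus Z * cminus W"
  "cplus 1 = 1" "cminus 1 = 1"
  by (simp_all add: cplus_def cminus_def complex_eq_iff algebra_simps)

text \<open>The type has zero divisors, so \<open>inverse\<close> and \<open>/\<close> are componentwise and are the
  actual inverse and quotient only where \<open>W dvd 1\<close>, i.e. where both components are nonzero.\<close>

instantiation bicomplex :: inverse
begin

definition "inverse W = idem (inverse (cplus W)) (inverse (cminus W))"
definition "Z div W = Z * inverse (W :: bicomplex)"

instance ..

end

lemma bicomplex_right_inverse:
  assumes "cplus W \<noteq> 0" "cminus W \<noteq> 0"
  shows "W * inverse W = 1"
proof -
  have "idem (cplus (W * inverse W)) (cminus (W * inverse W)) = idem (cplus 1) (cminus 1)"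
    using assms by (simp add: inverse_bicomplex_def)
  then show ?thesis
    by (simp only: idem_collapse)
qed

lemma bicomplex_unit_iff: "W dvd 1 \<longleftrightarrow> cplus W \<noteq> 0 \<and> cminus W \<noteq> 0"
proof
  assume "W dvd 1"
  then obtain V where "W * V = 1"
    by (metis dvdE)
  then have "cplus (W * V) = 1" "cminus (W * V) = 1"
    by (simp_all only: cplus_cminus_ring(5,6))
  then show "cplus W \<noteq> 0 \<and> cminus W \<noteq> 0"
    by auto
next
  assume "cplus W \<noteq> 0 \<and> cminus W \<noteq> 0"
  then have "1 = W * inverse W"
    by (simp add: bicomplex_right_inverse)
  then show "W dvd 1" ..
qed

definition bc_exp :: "bicomplex \<Rightarrow> bicomplex" where
  "bc_exp Z = idem (exp (cplus Z)) (exp (cminus Z))"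

definition bc_sqrt :: "bicomplex \<Rightarrow> bicomplex" where
  "bc_sqrt Z = idem (csqrt (cplus Z)) (csqrt (cminus Z))"

definition bc_star :: "bicomplex \<Rightarrow> bicomplex" where
  "bc_star Z = idem (cnj (cplus Z)) (cnj (cminus Z))"

definition bc_torus :: "bicomplex set" where
  "bc_torus = {idem \<alpha> \<beta> | \<alpha> \<beta>. \<alpha> \<in> sphere 0 1 \<and> \<beta> \<in> sphere 0 1}"

section \<open>The weighted bicomplex Lebesgue space\<close>

definition sq_integrable :: "real \<Rightarrow> (real \<Rightarrow> complex) \<Rightarrow> bool" where
  "sq_integrable \<sigma> f \<longleftrightarrow> f \<in> borel_measurable lborel \<and>
     integrable lborel (\<lambda>x. (cmod (f x))\<^sup>2 * exp (- \<sigma> * x\<^sup>2))"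

definition L2_fun :: "real \<Rightarrow> (real \<Rightarrow> bicomplex) set" where
  "L2_fun \<sigma> = {\<phi>. sq_integrable \<sigma> (\<lambda>x. cplus (\<phi> x)) \<and> sq_integrable \<sigma> (\<lambda>x. cminus (\<phi> x))}"

definition L2_inner :: "real \<Rightarrow> (real \<Rightarrow> bicomplex) \<Rightarrow> (real \<Rightarrow> bicomplex) \<Rightarrow> bicomplex" where
  "L2_inner \<sigma> \<phi> \<psi> = of_real (sqrt (\<sigma> / pi)) *
     (LINT x|lborel. \<phi> x * bc_star (\<psi> x) * of_real (exp (- \<sigma> * x\<^sup>2)))"

definition L2_norm :: "real \<Rightarrow> (real \<Rightarrow> bicomplex) \<Rightarrow> real" where
  "L2_norm \<sigma> \<phi> = sqrt ((Re (cplus (L2_inner \<sigma> \<phi> \<phi>)) + Re (cminus (L2_inner \<sigma> \<phi> \<phi>))) / 2)"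

definition L2_rel :: "real \<Rightarrow> ((real \<Rightarrow> bicomplex) \<times> (real \<Rightarrow> bicomplex)) set" where
  "L2_rel \<sigma> = {(\<phi>, \<psi>). \<phi> \<in> L2_fun \<sigma> \<and> \<psi> \<in> L2_fun \<sigma> \<and> (AE x in lborel. \<phi> x = \<psi> x)}"

definition L2_class :: "real \<Rightarrow> (real \<Rightarrow> bicomplex) \<Rightarrow> (real \<Rightarrow> bicomplex) set" where
  "L2_class \<sigma> \<phi> = L2_rel \<sigma> `` {\<phi>}"

definition L2_space :: "real \<Rightarrow> (real \<Rightarrow> bicomplex) set set" where
  "L2_space \<sigma> = L2_fun \<sigma> // L2_rel \<sigma>"

text \<open>Membership of the approximants has to be required explicitly, because \<open>L2_norm\<close> is
  \<open>0\<close> by convention where the defining integral diverges.\<close>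

definition L2_limit :: "real \<Rightarrow> (real \<Rightarrow> real \<Rightarrow> bicomplex) \<Rightarrow> (real \<Rightarrow> bicomplex) \<Rightarrow> bool" where
  "L2_limit \<sigma> f g \<longleftrightarrow> g \<in> L2_fun \<sigma> \<and> (\<forall>\<^sub>F R in at_top. f R \<in> L2_fun \<sigma>) \<and>
     ((\<lambda>R. L2_norm \<sigma> (\<lambda>x. f R x - g x)) \<longlongrightarrow> 0) at_top"

section \<open>The bicomplex fractional Fourier transform\<close>

definition frft_kernel :: "real \<Rightarrow> bicomplex \<Rightarrow> real \<Rightarrow> real \<Rightarrow> bicomplex" where
  "frft_kernel \<sigma> \<theta> y x =
     bc_exp (- (of_real \<sigma> / (1 - \<theta>\<^sup>2)) * (of_real x - \<theta> * of_real y)\<^sup>2)"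

text \<open>For \<open>\<theta>\<close> with both components on the unit circle (and \<open>1 - \<theta>\<^sup>2\<close> invertible) both
  components of the kernel have modulus \<open>exp (- \<sigma> x\<^sup>2 / 2 + \<sigma> y\<^sup>2 / 2)\<close>. Hence for \<open>\<psi>\<close> in the
  weighted space the integrand is square integrable but in general not integrable in \<open>x\<close>, and,
  as for the Fourier--Plancherel transform, the integral over the line is the limit in the norm
  of the space of the integrals over \<open>[-R, R]\<close>. The transform acts on classes modulo a.e. equality;
  \<open>frft \<sigma> \<theta> \<Psi>\<close> is the set of all functions that are such a limit.\<close>

definition frft_trunc ::
    "real \<Rightarrow> bicomplex \<Rightarrow> (real \<Rightarrow> bicomplex) \<Rightarrow> real \<Rightarrow> real \<Rightarrow> bicomplex" where
  "frft_trunc \<sigma> \<theta> \<psi> R y = of_real (sqrt (\<sigma> / pi)) / bc_sqrt (1 - \<theta>\<^sup>2) *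
     (LINT x:{-R..R}|lborel. \<psi> x * frft_kernel \<sigma> \<theta> y x)"

definition frft ::
    "real \<Rightarrow> bicomplex \<Rightarrow> (real \<Rightarrow> bicomplex) set \<Rightarrow> (real \<Rightarrow> bicomplex) set" where
  "frft \<sigma> \<theta> \<Psi> = {g. \<exists>\<psi>\<in>\<Psi>. L2_limit \<sigma> (frft_trunc \<sigma> \<theta> \<psi>) g}"

end

theory Submission
  imports Defs "HOL-Probability.Characteristic_Functions"
begin

text \<open>
  The two idempotent coordinates of a bicomplex function are transformed independently, so the
  theorem is a statement about complex functions and a parameter \<open>t\<close> with \<open>\<bar>t\<bar> = 1\<close> and
  \<open>t\<^sup>2 \<noteq> 1\<close>. For such \<open>t\<close> the number \<open>1 / (1 - t\<^sup>2)\<close> has real part \<open>1 / 2\<close> and \<open>t / (1 - t\<^sup>2)\<close> is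
  purely imaginary. Multiplication by \<open>exp (- \<sigma> * x\<^sup>2 / 2)\<close> carries the weighted space to the
  ordinary space of square-integrable functions, and there the transform becomes: multiply by a
  unimodular quadratic exponential (a chirp), take the Fourier transform at the frequency
  \<open>a = 2 * \<sigma> * Im (t / (1 - t\<^sup>2))\<close>, multiply by the chirp again and by a constant \<open>C\<close>
  (\<open>scalar_kernel_eq\<close>). Passing from \<open>t\<close> to its conjugate negates \<open>a\<close> and conjugates the chirp and
  \<open>C\<close>. The chirps therefore cancel in the composition, and since \<open>\<bar>C\<bar>\<^sup>2 * (2 * pi / \<bar>a\<bar>) = 1\<close> the
  theorem is Fourier inversion in the mean (\<open>plancherel_inversion\<close>).

  Fourier inversion is proved with a Gaussian regularising factor. Such a factor on the transform
  side amounts to a Gaussian average on the function side (\<open>fourier_regularised_inversion\<close>). This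
  gives first the bound \<open>sqnorm_fourier_le\<close>, hence by completeness (\<open>Riesz_Fischer\<close>) the existence
  and continuity of the transform in the mean. It also gives the inversion formula for the
  regularised transforms; as the regularisation is removed, one side converges in the mean and the
  other when integrated over any interval, and integrals over intervals determine a function
  almost everywhere.

  The pointwise formula holds because truncated integrals that converge at a point to the full
  integral must agree there, up to a null set, with their limit in the mean
  (\<open>sqnorm_limit_pointwise\<close>).
\<close>

section \<open>Square-integrable functions on the line\<close>

text \<open>The square of the norm, as an extended real, so that divergent cases carry the value
  \<open>\<infinity>\<close> and Fatou's lemma and Cauchy--Schwarz apply directly.\<close>

definition sqnorm :: "(real \<Rightarrow> complex) \<Rightarrow> ennreal" where
  "sqnorm f = (\<integral>\<^sup>+x. ennreal ((cmod (f x))\<^sup>2) \<partial>lborel)"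

definition square_integrable :: "(real \<Rightarrow> complex) \<Rightarrow> bool" where
  "square_integrable f \<longleftrightarrow> f \<in> borel_measurable borel \<and> sqnorm f < \<infinity>"

text \<open>The ordinary Fourier integral, with the frequency as a parameter of either sign, so that the
  transform and its inverse are instances of one definition.\<close>

definition fourier :: "real \<Rightarrow> (real \<Rightarrow> complex) \<Rightarrow> real \<Rightarrow> complex" where
  "fourier a f y = (\<integral>x. f x * cis (a * x * y) \<partial>lborel)"

definition cutoff :: "real \<Rightarrow> (real \<Rightarrow> complex) \<Rightarrow> real \<Rightarrow> complex" where
  "cutoff R f x = indicator {-R..R} x * f x"

lemma square_integrable_measurable [measurable_dest]: "square_integrable f \<Longrightarrow> f \<in> borel_measurable borel"
  by (simp add: square_integrable_def)

lemma measurable_cis [measurable]: "cis \<in> borel_measurable borel"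
  by (intro borel_measurable_continuous_onI continuous_intros)

lemma measurable_cutoff [measurable]:
  "f \<in> borel_measurable borel \<Longrightarrow> cutoff R f \<in> borel_measurable borel"
  unfolding cutoff_def[abs_def] by measurable

lemma measurable_fourier [measurable]:
  assumes [measurable]: "f \<in> borel_measurable borel"
  shows "fourier a f \<in> borel_measurable borel"
  unfolding fourier_def[abs_def] by measurable

lemma sqnorm_mono:
  assumes "\<And>x. cmod (f x) \<le> cmod (g x)"
  shows "sqnorm f \<le> sqnorm g"
  unfolding sqnorm_def by (intro nn_integral_mono ennreal_leI power_mono assms norm_ge_zero)

lemma sqnorm_cong:
  assumes "\<And>x. cmod (f x) = cmod (g x)"
  shows "sqnorm f = sqnorm g"
  by (simp add: sqnorm_def assms)

lemma sqnorm_cong_AE: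
  assumes "AE x in lborel. f x = g x"
  shows "sqnorm f = sqnorm g"
  unfolding sqnorm_def by (intro nn_integral_cong_AE) (use assms in eventually_elim, simp)

lemma sqnorm_cmult:
  assumes [measurable]: "f \<in> borel_measurable borel"
  shows "sqnorm (\<lambda>x. c * f x) = ennreal ((cmod c)\<^sup>2) * sqnorm f"
  unfolding sqnorm_def
  by (subst nn_integral_cmult [symmetric]) (auto simp: norm_mult power_mult_distrib ennreal_mult)

lemma cmod_add_sq: "(cmod (u + v))\<^sup>2 \<le> 2 * (cmod u)\<^sup>2 + 2 * (cmod v)\<^sup>2"
proof -
  have "(cmod (u + v))\<^sup>2 \<le> (cmod u + cmod v)\<^sup>2"
    by (intro power_mono norm_triangle_ineq) auto
  also have "\<dots> \<le> 2 * (cmod u)\<^sup>2 + 2 * (cmod v)\<^sup>2"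
    using sum_squares_bound[of "cmod u" "cmod v"] by (simp add: power2_sum)
  finally show ?thesis .
qed

lemma sqnorm_add:
  assumes [measurable]: "f \<in> borel_measurable borel" "g \<in> borel_measurable borel"
  shows "sqnorm (\<lambda>x. f x + g x) \<le> 2 * sqnorm f + 2 * sqnorm g"
proof -
  have "sqnorm (\<lambda>x. f x + g x) \<le>
      (\<integral>\<^sup>+x. 2 * ennreal ((cmod (f x))\<^sup>2) + 2 * ennreal ((cmod (g x))\<^sup>2) \<partial>lborel)"
    unfolding sqnorm_def
  proof (intro nn_integral_mono)
    fix x
    have "ennreal ((cmod (f x + g x))\<^sup>2) \<le> ennreal (2 * (cmod (f x))\<^sup>2 + 2 * (cmod (g x))\<^sup>2)"
      by (intro ennreal_leI cmod_add_sq)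
    also have "\<dots> = 2 * ennreal ((cmod (f x))\<^sup>2) + 2 * ennreal ((cmod (g x))\<^sup>2)"
      by (simp add: ennreal_plus ennreal_mult)
    finally show "ennreal ((cmod (f x + g x))\<^sup>2) \<le>
      2 * ennreal ((cmod (f x))\<^sup>2) + 2 * ennreal ((cmod (g x))\<^sup>2)" .
  qed
  also have "\<dots> = 2 * sqnorm f + 2 * sqnorm g"
    unfolding sqnorm_def by (simp add: nn_integral_add nn_integral_cmult)
  finally show ?thesis .
qed

lemma sqnorm_minus_commute: "sqnorm (\<lambda>x. f x - g x) = sqnorm (\<lambda>x. g x - f x)"
  by (intro sqnorm_cong norm_minus_commute)

lemma sqnorm_triangle:
  assumes [measurable]: "f \<in> borel_measurable borel" "g \<in> borel_measurable borel"
    "h \<in> borel_measurable borel"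
  shows "sqnorm (\<lambda>x. f x - h x) \<le> 2 * sqnorm (\<lambda>x. f x - g x) + 2 * sqnorm (\<lambda>x. g x - h x)"
  using sqnorm_add[of "\<lambda>x. f x - g x" "\<lambda>x. g x - h x"] by simp

lemma sqnorm_eq_0:
  assumes [measurable]: "f \<in> borel_measurable borel"
  assumes "sqnorm f = 0"
  shows "AE x in lborel. f x = 0"
  using assms(2) unfolding sqnorm_def by (subst (asm) nn_integral_0_iff_AE) auto

lemma double_sum_finite: "x < \<infinity> \<Longrightarrow> y < \<infinity> \<Longrightarrow> 2 * x + 2 * y < (\<infinity>::ennreal)"
  by (simp add: ennreal_mult_less_top)

lemma square_integrable_add: "square_integrable f \<Longrightarrow> square_integrable g \<Longrightarrow> square_integrable (\<lambda>x. f x + g x)"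
  unfolding square_integrable_def
  using sqnorm_add[of f g] double_sum_finite[of "sqnorm f" "sqnorm g"] by (auto intro: le_less_trans)

lemma square_integrable_cmult: "square_integrable f \<Longrightarrow> square_integrable (\<lambda>x. c * f x)"
  unfolding square_integrable_def by (auto simp: sqnorm_cmult ennreal_mult_less_top)

lemma square_integrable_diff: "square_integrable f \<Longrightarrow> square_integrable g \<Longrightarrow> square_integrable (\<lambda>x. f x - g x)"
  using square_integrable_add[OF _ square_integrable_cmult[of g "-1"]] by simp

lemma square_integrable_dominated:
  assumes "square_integrable f" "g \<in> borel_measurable borel" "\<And>x. cmod (g x) \<le> cmod (f x)"
  shows "square_integrable g"
  using assms sqnorm_mono[of g f] by (auto simp: square_integrable_def intro: le_less_trans)

lemma square_integrable_limit:
  assumes "square_integrable f" "g \<in> borel_measurable borel" "sqnorm (\<lambda>x. f x - g x) < \<infinity>"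
  shows "square_integrable g"
proof -
  have [measurable]: "f \<in> borel_measurable borel" "g \<in> borel_measurable borel"
    using assms by auto
  have "square_integrable (\<lambda>x. f x - g x)"
    using assms by (simp add: square_integrable_def)
  from square_integrable_diff[OF assms(1) this] show ?thesis
    by simp
qed

lemma square_integrable_cutoff: "square_integrable f \<Longrightarrow> square_integrable (cutoff R f)"
  by (rule square_integrable_dominated[of f]) (auto simp: cutoff_def indicator_def)

lemma square_integrable_integrable_sq: "square_integrable f \<Longrightarrow> integrable lborel (\<lambda>x. (cmod (f x))\<^sup>2)"
  unfolding square_integrable_def sqnorm_def by (auto intro!: integrableI_bounded)

lemma integrable_sq_square_integrable:
  "f \<in> borel_measurable borel \<Longrightarrow> integrable lborel (\<lambda>x. (cmod (f x))\<^sup>2) \<Longrightarrow> square_integrable f"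
  unfolding square_integrable_def sqnorm_def by (auto simp: integrable_iff_bounded)

lemma sqnorm_eq_integral: "square_integrable f \<Longrightarrow> sqnorm f = ennreal (\<integral>x. (cmod (f x))\<^sup>2 \<partial>lborel)"
  unfolding sqnorm_def by (rule nn_integral_eq_integral) (auto intro: square_integrable_integrable_sq)

lemma square_integrable_mult_integrable:
  assumes "square_integrable f" "square_integrable g"
  shows "integrable lborel (\<lambda>x. f x * g x)"
proof (rule Bochner_Integration.integrable_bound)
  show "integrable lborel (\<lambda>x. (cmod (f x))\<^sup>2 + (cmod (g x))\<^sup>2)"
    using assms by (intro Bochner_Integration.integrable_add square_integrable_integrable_sq)
  have [measurable]: "f \<in> borel_measurable borel" "g \<in> borel_measurable borel"
    using assms by auto
  show "(\<lambda>x. f x * g x) \<in> borel_measurable lborel"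
    by measurable
  have "cmod (f x * g x) \<le> (cmod (f x))\<^sup>2 + (cmod (g x))\<^sup>2" for x
    using sum_squares_bound[of "cmod (f x)" "cmod (g x)"]
      mult_nonneg_nonneg[OF norm_ge_zero norm_ge_zero, of "f x" "g x"]
    unfolding norm_mult by linarith
  then show "AE x in lborel. cmod (f x * g x) \<le> norm ((cmod (f x))\<^sup>2 + (cmod (g x))\<^sup>2)"
    by simp
qed

lemma square_integrable_indicator: "square_integrable (indicator {a..b::real})"
proof (rule integrable_sq_square_integrable)
  have "(\<lambda>x. (cmod (indicator {a..b} x))\<^sup>2) = (indicator {a..b} :: real \<Rightarrow> real)"
    by (auto simp: indicator_def)
  moreover have "integrable lborel (indicator {a..b} :: real \<Rightarrow> real)"
    by (rule integrable_real_indicator) (auto simp: emeasure_lborel_Icc_eq)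
  ultimately show "integrable lborel (\<lambda>x. (cmod (indicator {a..b} x))\<^sup>2)"
    by simp
qed auto

lemma integrable_cutoff: "square_integrable f \<Longrightarrow> integrable lborel (cutoff R f)"
  unfolding cutoff_def[abs_def] by (rule square_integrable_mult_integrable[OF square_integrable_indicator])

lemma integrable_mult_cis:
  assumes "integrable lborel f"
  shows "integrable lborel (\<lambda>x. f x * cis (a * x * y))"
  using assms by (rule Bochner_Integration.integrable_bound)
    (use assms in \<open>auto simp: norm_mult dest!: borel_measurable_integrable\<close>)

lemma fourier_diff:
  assumes "integrable lborel f" "integrable lborel g"
  shows "fourier a (\<lambda>x. f x - g x) y = fourier a f y - fourier a g y"
  unfolding fourier_def left_diff_distrib
  using assms by (intro Bochner_Integration.integral_diff integrable_mult_cis)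

lemma fourier_cmult: "fourier a (\<lambda>x. c * f x) y = c * fourier a f y"
  unfolding fourier_def by (simp add: mult.assoc)

lemma norm_fourier_le: "cmod (fourier a f y) \<le> (\<integral>x. cmod (f x) \<partial>lborel)"
  unfolding fourier_def by (rule order_trans[OF integral_norm_bound]) (simp add: norm_mult)

text \<open>Cauchy--Schwarz against an interval: this turns convergence in the mean into convergence of
  the integrals over every interval, the test by which limits are identified below.\<close>

lemma norm_integral_interval_le:
  assumes "square_integrable f"
  shows "ennreal ((cmod (\<integral>x. indicator {a..b} x * f x \<partial>lborel))\<^sup>2) \<le> emeasure lborel {a..b} * sqnorm f"
proof -
  have [measurable]: "f \<in> borel_measurable borel"
    using assms by auto
  have "ennreal (cmod (\<integral>x. indicator {a..b} x * f x \<partial>lborel)) \<le>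
      (\<integral>\<^sup>+x. ennreal (cmod (indicator {a..b} x * f x)) \<partial>lborel)"
    using integral_norm_bound_ennreal[OF square_integrable_mult_integrable[OF square_integrable_indicator assms]] by simp
  also have "\<dots> = (\<integral>\<^sup>+x. indicator {a..b} x * ennreal (cmod (f x)) \<partial>lborel)"
    by (intro nn_integral_cong) (auto simp: indicator_def)
  finally have "(ennreal (cmod (\<integral>x. indicator {a..b} x * f x \<partial>lborel)))\<^sup>2 \<le>
      (\<integral>\<^sup>+x. indicator {a..b} x * ennreal (cmod (f x)) \<partial>lborel)\<^sup>2"
    by (intro power_mono) auto
  also have "\<dots> \<le> (\<integral>\<^sup>+x. (indicator {a..b} x)\<^sup>2 \<partial>lborel) * (\<integral>\<^sup>+x. (ennreal (cmod (f x)))\<^sup>2 \<partial>lborel)"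
    by (rule Cauchy_Schwarz_nn_integral) auto
  also have "(\<integral>\<^sup>+x. (indicator {a..b} x)\<^sup>2 \<partial>lborel) = emeasure lborel {a..b}"
    by (subst nn_integral_indicator[symmetric])
      (auto intro!: nn_integral_cong simp: indicator_def simp del: nn_integral_indicator)
  also have "(\<integral>\<^sup>+x. (ennreal (cmod (f x)))\<^sup>2 \<partial>lborel) = sqnorm f"
    unfolding sqnorm_def by (simp add: ennreal_power)
  finally show ?thesis
    by (simp add: ennreal_power)
qed

section \<open>The Gaussian bound for the Fourier integral\<close>

lemma integrable_product_kernel:
  fixes f g :: "real \<Rightarrow> complex"
  assumes f: "integrable lborel f" and g: "integrable lborel g"
    and [measurable]: "case_prod K \<in> borel_measurable (borel \<Otimes>\<^sub>M borel)"
    and K: "\<And>x y. cmod (K x y) \<le> B"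
  shows "integrable (lborel \<Otimes>\<^sub>M lborel) (\<lambda>(x, y). f x * g y * K x y)"
proof -
  have [measurable]: "f \<in> borel_measurable borel" "g \<in> borel_measurable borel"
    using f g by (auto dest!: borel_measurable_integrable)
  have "integrable (lborel \<Otimes>\<^sub>M lborel) (\<lambda>(x, y). f x * g y)"
  proof (rule lborel_pair.Fubini_integrable)
    show "integrable lborel (\<lambda>x. \<integral>y. norm (case (x, y) of (x, y) \<Rightarrow> f x * g y) \<partial>lborel)"
      using f by (simp add: norm_mult)
  qed (use g in auto)
  then have "integrable (lborel \<Otimes>\<^sub>M lborel) (\<lambda>p. B * norm (case p of (x, y) \<Rightarrow> f x * g y))"
    by (intro integrable_mult_right integrable_norm)
  then show ?thesis
  proof (rule Bochner_Integration.integrable_bound)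
    show "AE p in lborel \<Otimes>\<^sub>M lborel. norm (case p of (x, y) \<Rightarrow> f x * g y * K x y) \<le>
        norm (B * norm (case p of (x, y) \<Rightarrow> f x * g y))"
    proof (intro AE_I2, safe)
      fix x y :: real
      have "norm (f x * g y * K x y) \<le> norm (f x * g y) * B"
        unfolding norm_mult[of "f x * g y"] by (intro mult_left_mono K) auto
      then show "norm (f x * g y * K x y) \<le> norm (B * norm (f x * g y))"
        by (simp add: mult.commute) 
    qed
  qed measurable
qed

text \<open>Fubini: both sides are the double integral of \<open>f x * g y * cis (a * x * y)\<close>. The two
  uses below are to undo a Fourier transform against a Gaussian and to compute its norm.\<close>

lemma fourier_multiplication:
  assumes f: "integrable lborel f" and g: "integrable lborel g"
  shows "(\<integral>y. g y * fourier a f y \<partial>lborel) = (\<integral>x. f x * fourier a g x \<partial>lborel)"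
proof -
  have "integrable (lborel \<Otimes>\<^sub>M lborel) (\<lambda>(x, y). f x * g y * cis (a * x * y))"
    by (rule integrable_product_kernel[OF f g, where B = 1]) auto
  note Fub = lborel_pair.Fubini_integral[OF this]
  have "(\<integral>y. g y * fourier a f y \<partial>lborel) =
      (\<integral>y. (\<integral>x. f x * g y * cis (a * x * y) \<partial>lborel) \<partial>lborel)"
    unfolding fourier_def integral_mult_right_zero[symmetric] by (simp add: ac_simps)
  also have "\<dots> = (\<integral>x. (\<integral>y. f x * g y * cis (a * x * y) \<partial>lborel) \<partial>lborel)"
    by (rule Fub)
  also have "\<dots> = (\<integral>x. f x * fourier a g x \<partial>lborel)"
    unfolding fourier_def integral_mult_right_zero[symmetric] by (simp add: ac_simps)
  finally show ?thesis .
qed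

text \<open>The regularising factor; it tends to \<open>1\<close> as \<open>s\<close> tends to \<open>0\<close>.\<close>

definition gauss :: "real \<Rightarrow> real \<Rightarrow> real" where
  "gauss s y = exp (- (s * y)\<^sup>2 / 2)"

lemma measurable_gauss [measurable]: "gauss s \<in> borel_measurable borel"
  unfolding gauss_def[abs_def] by measurable

lemma gauss_eq_density:
  assumes "s > 0"
  shows "gauss s y = sqrt (2 * pi) / s * normal_density 0 (1 / s) y"
  using assms
  by (simp add: gauss_def normal_density_def real_sqrt_mult real_sqrt_divide power_divide
      power_mult_distrib field_simps)

lemma integrable_gauss:
  assumes "s > 0"
  shows "integrable lborel (gauss s)"
proof -
  have "gauss s = (\<lambda>y. sqrt (2 * pi) / s * normal_density 0 (1 / s) y)"
    using assms by (intro ext gauss_eq_density)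
  then show ?thesis
    using assms by (simp add: integrable_normal_density)
qed

lemma gauss_pos: "gauss s y > 0" and gauss_le_1: "gauss s y \<le> 1"
  by (simp_all add: gauss_def)

lemma std_normal_fourier:
  "(\<integral>y. complex_of_real (std_normal_density y) * cis (t * y) \<partial>lborel) = complex_of_real (exp (- t\<^sup>2 / 2))"
proof -
  have "char std_normal_distribution t =
      (\<integral>y. std_normal_density y *\<^sub>R cis (t * y) \<partial>lborel)"
    unfolding char_def by (subst integral_density) (auto simp: cis_conv_exp)
  then show ?thesis
    by (simp add: char_std_normal_distribution scaleR_conv_of_real)
qed

text \<open>The characteristic function of the standard normal distribution, rescaled. The width of the
  regularising factor is chosen so that its transform is a constant multiple of the normal density
  of standard deviation \<open>s\<close>.\<close>

lemma fourier_gauss: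
  assumes "a \<noteq> 0" "s > 0"
  shows "fourier a (\<lambda>y. complex_of_real (gauss (\<bar>a\<bar> * s) y)) z =
    complex_of_real (2 * pi / \<bar>a\<bar> * normal_density 0 s z)"
proof -
  have "complex_of_real (exp (- (z / s)\<^sup>2 / 2)) =
      (\<integral>y. complex_of_real (std_normal_density y) * cis (z / s * y) \<partial>lborel)"
    by (rule std_normal_fourier[symmetric])
  \<comment> \<open>The substitution \<open>y := a * s * y\<close> turns the standard normal density into the factor of
    inverse width \<open>\<bar>a\<bar> * s\<close>.\<close>
  also have "\<dots> = \<bar>a * s\<bar> *\<^sub>R (\<integral>y. complex_of_real (std_normal_density (0 + a * s * y)) * cis (z / s * (0 + a * s * y)) \<partial>lborel)"
    using assms by (intro lborel_integral_real_affine) auto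
  also have "(\<integral>y. complex_of_real (std_normal_density (0 + a * s * y)) * cis (z / s * (0 + a * s * y)) \<partial>lborel) =
      (\<integral>y. complex_of_real (1 / sqrt (2 * pi)) * (complex_of_real (gauss (\<bar>a\<bar> * s) y) * cis (a * y * z)) \<partial>lborel)"
    using assms by (intro Bochner_Integration.integral_cong)
      (auto simp: gauss_def std_normal_density_def power_mult_distrib field_simps)
  also have "\<dots> = complex_of_real (1 / sqrt (2 * pi)) * fourier a (\<lambda>y. complex_of_real (gauss (\<bar>a\<bar> * s) y)) z"
    unfolding fourier_def by simp
  finally have *: "complex_of_real (exp (- (z / s)\<^sup>2 / 2)) =
    complex_of_real (\<bar>a\<bar> * s / sqrt (2 * pi)) * fourier a (\<lambda>y. complex_of_real (gauss (\<bar>a\<bar> * s) y)) z"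
    using assms by (simp add: scaleR_conv_of_real abs_mult)
  have nd: "2 * pi / \<bar>a\<bar> * normal_density 0 s z = sqrt (2 * pi) / (\<bar>a\<bar> * s) * exp (- (z / s)\<^sup>2 / 2)"
    using assms by (simp add: normal_density_def real_sqrt_mult power_divide field_simps)
  show ?thesis
    unfolding nd of_real_mult * using assms by simp
qed

text \<open>Convolution with the centred normal density of standard deviation \<open>s\<close>.\<close>

definition gauss_average :: "real \<Rightarrow> (real \<Rightarrow> complex) \<Rightarrow> real \<Rightarrow> complex" where
  "gauss_average s f x = (\<integral>u. f u * complex_of_real (normal_density x s u) \<partial>lborel)"

lemma normal_density_swap: "normal_density x s u = normal_density u s x"
  by (simp add: normal_density_def power2_commute)

lemma measurable_gauss_average [measurable]:
  assumes [measurable]: "f \<in> borel_measurable borel"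
  shows "gauss_average s f \<in> borel_measurable borel"
  unfolding gauss_average_def[abs_def] normal_density_def by measurable

text \<open>The multiplication formula moves the transform from \<open>f\<close> to the Gaussian factor,
  whose transform is a normal density centred at \<open>x\<close>. So inverting a regularised transform gives
  a Gaussian average of the original function.\<close>

lemma fourier_regularised_inversion:
  assumes f: "integrable lborel f" and "a \<noteq> 0" "s > 0"
  shows "fourier (- a) (\<lambda>y. complex_of_real (gauss (\<bar>a\<bar> * s) y) * fourier a f y) x =
    complex_of_real (2 * pi / \<bar>a\<bar>) * gauss_average s f x"
proof -
  let ?w = "\<lambda>y. complex_of_real (gauss (\<bar>a\<bar> * s) y)"
  let ?g = "\<lambda>y. ?w y * cis (- a * y * x)"
  have w: "integrable lborel ?w"
    using assms by (intro integrable_of_real integrable_gauss) auto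
  then have g: "integrable lborel ?g"
    by (rule integrable_mult_cis)
  have "fourier (- a) (\<lambda>y. ?w y * fourier a f y) x = (\<integral>y. ?g y * fourier a f y \<partial>lborel)"
    unfolding fourier_def[of "-a"] by (simp add: ac_simps)
  also have "\<dots> = (\<integral>u. f u * fourier a ?g u \<partial>lborel)"
    by (rule fourier_multiplication[OF f g])
  also have "\<dots> = (\<integral>u. complex_of_real (2 * pi / \<bar>a\<bar>) * (f u * complex_of_real (normal_density x s u)) \<partial>lborel)"
  proof (intro Bochner_Integration.integral_cong refl)
    fix u
    have "fourier a ?g u = fourier a ?w (u - x)"
      unfolding fourier_def by (simp add: mult.assoc cis_mult) (simp add: algebra_simps)
    also have "\<dots> = complex_of_real (2 * pi / \<bar>a\<bar>) * complex_of_real (normal_density x s u)"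
      using assms by (simp add: fourier_gauss normal_density_def)
    finally show "f u * fourier a ?g u =
        complex_of_real (2 * pi / \<bar>a\<bar>) * (f u * complex_of_real (normal_density x s u))"
      by simp
  qed
  finally show ?thesis
    unfolding gauss_average_def by simp
qed

lemma nn_integral_normal_density: "s > 0 \<Longrightarrow> (\<integral>\<^sup>+u. ennreal (normal_density x s u) \<partial>lborel) = 1"
  by (subst nn_integral_eq_integral) (auto simp: integral_normal_density)

text \<open>The mean inequality bounds \<open>\<bar>f x\<bar> * \<bar>f u\<bar>\<close> by half the sum of the squares, and the normal
  density integrates to \<open>1\<close> in either variable.\<close>

lemma gauss_average_form_le:
  assumes [measurable]: "f \<in> borel_measurable borel" and s: "s > 0"
  shows "(\<integral>\<^sup>+x. \<integral>\<^sup>+u. ennreal (cmod (f x) * cmod (f u) * normal_density x s u) \<partial>lborel \<partial>lborel) \<le> sqnorm f"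
proof -
  define h where "h x = ennreal ((cmod (f x))\<^sup>2 / 2)" for x
  have [measurable]: "h \<in> borel_measurable borel"
    unfolding h_def[abs_def] by measurable
  have "(\<integral>\<^sup>+x. \<integral>\<^sup>+u. ennreal (cmod (f x) * cmod (f u) * normal_density x s u) \<partial>lborel \<partial>lborel) \<le>
    (\<integral>\<^sup>+x. \<integral>\<^sup>+u. h x * ennreal (normal_density x s u) + h u * ennreal (normal_density x s u) \<partial>lborel \<partial>lborel)"
  proof (intro nn_integral_mono)
    fix x u
    have "cmod (f x) * cmod (f u) * normal_density x s u \<le>
        ((cmod (f x))\<^sup>2 / 2 + (cmod (f u))\<^sup>2 / 2) * normal_density x s u"
      using sum_squares_bound[of "cmod (f x)" "cmod (f u)"] by (intro mult_right_mono) auto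
    then have "ennreal (cmod (f x) * cmod (f u) * normal_density x s u) \<le>
        ennreal (((cmod (f x))\<^sup>2 / 2 + (cmod (f u))\<^sup>2 / 2) * normal_density x s u)"
      by (rule ennreal_leI)
    also have "\<dots> = h x * ennreal (normal_density x s u) + h u * ennreal (normal_density x s u)"
      by (simp add: h_def distrib_right flip: ennreal_mult)
    finally show "ennreal (cmod (f x) * cmod (f u) * normal_density x s u) \<le>
      h x * ennreal (normal_density x s u) + h u * ennreal (normal_density x s u)" .
  qed
  also have "\<dots> = (\<integral>\<^sup>+x. \<integral>\<^sup>+u. h x * ennreal (normal_density x s u) \<partial>lborel \<partial>lborel) +
      (\<integral>\<^sup>+x. \<integral>\<^sup>+u. h u * ennreal (normal_density x s u) \<partial>lborel \<partial>lborel)"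
    unfolding normal_density_def by (simp add: nn_integral_add)
  also have "(\<integral>\<^sup>+x. \<integral>\<^sup>+u. h u * ennreal (normal_density x s u) \<partial>lborel \<partial>lborel) =
      (\<integral>\<^sup>+u. \<integral>\<^sup>+x. h u * ennreal (normal_density u s x) \<partial>lborel \<partial>lborel)"
    by (subst lborel_pair.Fubini') (auto simp: normal_density_def power2_commute)
  also have "(\<integral>\<^sup>+x. \<integral>\<^sup>+u. h x * ennreal (normal_density x s u) \<partial>lborel \<partial>lborel) = (\<integral>\<^sup>+x. h x \<partial>lborel)"
    by (simp add: nn_integral_cmult nn_integral_normal_density s)
  also have "(\<integral>\<^sup>+x. h x \<partial>lborel) + (\<integral>\<^sup>+x. h x \<partial>lborel) = (\<integral>\<^sup>+x. h x + h x \<partial>lborel)"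
    by (simp add: nn_integral_add)
  also have "\<dots> = sqnorm f"
    unfolding sqnorm_def h_def by (intro nn_integral_cong) (simp add: ennreal_plus[symmetric] del: ennreal_plus)
  finally show ?thesis .
qed

lemma cnj_fourier:
  "cnj (fourier a f y) = fourier (- a) (\<lambda>x. cnj (f x)) y"
  unfolding fourier_def by (subst Bochner_Integration.integral_cnj[symmetric]) (simp add: cis_cnj)

lemma gauss_tendsto_1:
  "((\<lambda>n. gauss (b * (1 / real (Suc n))) y) \<longlonglongrightarrow> 1)"
proof -
  have "(\<lambda>n. exp (- (b * (1 / real (Suc n)) * y)\<^sup>2 / 2)) \<longlonglongrightarrow> exp (- (b * 0 * y)\<^sup>2 / 2)"
    by (intro tendsto_intros LIMSEQ_inverse_real_of_nat[unfolded inverse_eq_divide]) auto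
  then show ?thesis
    by (simp add: gauss_def)
qed

lemma integrable_gauss_fourier:
  assumes f: "integrable lborel f" and "s > 0"
  shows "integrable lborel (\<lambda>y. complex_of_real (gauss s y) * fourier a f y)"
proof (rule Bochner_Integration.integrable_bound)
  have [measurable]: "f \<in> borel_measurable borel"
    using f by (auto dest!: borel_measurable_integrable)
  show "integrable lborel (\<lambda>y. gauss s y * (\<integral>x. cmod (f x) \<partial>lborel))"
    by (intro integrable_mult_left integrable_gauss assms)
  show "AE y in lborel. norm (complex_of_real (gauss s y) * fourier a f y) \<le>
      norm (gauss s y * (\<integral>x. cmod (f x) \<partial>lborel))"
    by (intro AE_I2)
      (auto simp: norm_mult abs_mult intro!: mult_left_mono norm_fourier_le order_trans[OF _ abs_ge_self]
        less_imp_le[OF gauss_pos])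
  show "(\<lambda>y. complex_of_real (gauss s y) * fourier a f y) \<in> borel_measurable lborel"
    by measurable
qed

text \<open>The multiplication formula rewrites the left-hand side as \<open>2 * pi / \<bar>a\<bar>\<close> times the pairing
  of \<open>f\<close> with its Gaussian average, which is at most the square of the norm of \<open>f\<close>.\<close>

lemma weighted_fourier_bound:
  assumes f: "integrable lborel f" and "a \<noteq> 0" "s > 0"
  shows "(\<integral>\<^sup>+y. ennreal (gauss (\<bar>a\<bar> * s) y * (cmod (fourier a f y))\<^sup>2) \<partial>lborel) \<le> ennreal (2 * pi / \<bar>a\<bar>) * sqnorm f"
proof -
  let ?w = "\<lambda>y. complex_of_real (gauss (\<bar>a\<bar> * s) y)"
  let ?F = "fourier a f"
  define c where "c = 2 * pi / \<bar>a\<bar>"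
  have c: "c > 0" using assms by (simp add: c_def)
  have [measurable]: "f \<in> borel_measurable borel"
    using f by (auto dest!: borel_measurable_integrable)
  have w: "integrable lborel (gauss (\<bar>a\<bar> * s))"
    using assms by (intro integrable_gauss) auto
  define M where "M = (\<integral>x. cmod (f x) \<partial>lborel)"
  have FM: "cmod (?F y) \<le> M" for y
    unfolding M_def by (rule norm_fourier_le)
  have M0: "M \<ge> 0" using FM[of 0] norm_ge_zero order_trans by blast
  have int1: "integrable lborel (\<lambda>y. ?w y * ?F y)"
    using assms by (intro integrable_gauss_fourier) auto
  have int2: "integrable lborel (\<lambda>y. gauss (\<bar>a\<bar> * s) y * (cmod (?F y))\<^sup>2)"
  proof (rule Bochner_Integration.integrable_bound[OF integrable_mult_left[OF w, of "M\<^sup>2"]])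
    show "AE y in lborel. norm (gauss (\<bar>a\<bar> * s) y * (cmod (?F y))\<^sup>2) \<le> norm (gauss (\<bar>a\<bar> * s) y * M\<^sup>2)"
      using FM gauss_pos[THEN less_imp_le] M0
      by (intro AE_I2) (auto simp: abs_mult intro!: mult_left_mono power_mono)
  qed measurable
  have "complex_of_real (\<integral>y. gauss (\<bar>a\<bar> * s) y * (cmod (?F y))\<^sup>2 \<partial>lborel) =
      (\<integral>y. (?w y * ?F y) * fourier (- a) (\<lambda>x. cnj (f x)) y \<partial>lborel)"
    unfolding integral_complex_of_real[symmetric] cnj_fourier[symmetric]
    by (simp add: mult.assoc complex_norm_square[symmetric] power2_eq_square del: of_real_power)
  also have "\<dots> = (\<integral>x. cnj (f x) * fourier (- a) (\<lambda>y. ?w y * ?F y) x \<partial>lborel)"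
    using f by (intro fourier_multiplication int1) simp
  also have "\<dots> = (\<integral>x. cnj (f x) * (complex_of_real c * gauss_average s f x) \<partial>lborel)"
    by (simp add: fourier_regularised_inversion assms c_def)
  also have "\<dots> = complex_of_real c * (\<integral>x. cnj (f x) * gauss_average s f x \<partial>lborel)"
    by (simp add: mult.left_commute)
  finally have eq: "complex_of_real (\<integral>y. gauss (\<bar>a\<bar> * s) y * (cmod (?F y))\<^sup>2 \<partial>lborel) =
    complex_of_real c * (\<integral>x. cnj (f x) * gauss_average s f x \<partial>lborel)" .
  have "(\<integral>\<^sup>+y. ennreal (gauss (\<bar>a\<bar> * s) y * (cmod (?F y))\<^sup>2) \<partial>lborel) =
      ennreal (\<integral>y. gauss (\<bar>a\<bar> * s) y * (cmod (?F y))\<^sup>2 \<partial>lborel)"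
    using gauss_pos[THEN less_imp_le] by (intro nn_integral_eq_integral int2) auto
  also have "\<dots> \<le> ennreal (cmod (complex_of_real (\<integral>y. gauss (\<bar>a\<bar> * s) y * (cmod (?F y))\<^sup>2 \<partial>lborel)))"
    by (intro ennreal_leI) simp
  also have "\<dots> = ennreal c * ennreal (cmod (\<integral>x. cnj (f x) * gauss_average s f x \<partial>lborel))"
    unfolding eq using c by (simp add: norm_mult ennreal_mult)
  also have "ennreal (cmod (\<integral>x. cnj (f x) * gauss_average s f x \<partial>lborel)) \<le>
      (\<integral>\<^sup>+x. ennreal (cmod (cnj (f x) * gauss_average s f x)) \<partial>lborel)"
    by (cases "integrable lborel (\<lambda>x. cnj (f x) * gauss_average s f x)")
      (auto intro: integral_norm_bound_ennreal simp: not_integrable_integral_eq)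
  also have "\<dots> \<le> (\<integral>\<^sup>+x. \<integral>\<^sup>+u. ennreal (cmod (f x) * cmod (f u) * normal_density x s u) \<partial>lborel \<partial>lborel)"
  proof (intro nn_integral_mono)
    fix x
    have "ennreal (cmod (gauss_average s f x)) \<le> (\<integral>\<^sup>+u. ennreal (cmod (f u * complex_of_real (normal_density x s u))) \<partial>lborel)"
      unfolding gauss_average_def
      by (cases "integrable lborel (\<lambda>u. f u * complex_of_real (normal_density x s u))")
       (auto intro: integral_norm_bound_ennreal simp: not_integrable_integral_eq)
    then have "ennreal (cmod (f x)) * ennreal (cmod (gauss_average s f x)) \<le>
      ennreal (cmod (f x)) * (\<integral>\<^sup>+u. ennreal (cmod (f u * complex_of_real (normal_density x s u))) \<partial>lborel)"
      by (rule mult_left_mono) simp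
    also have "\<dots> = (\<integral>\<^sup>+u. ennreal (cmod (f x) * cmod (f u) * normal_density x s u) \<partial>lborel)"
      by (subst nn_integral_cmult[symmetric]) (auto simp: norm_mult ennreal_mult mult.assoc)
    finally show "ennreal (cmod (cnj (f x) * gauss_average s f x)) \<le> \<dots>"
      by (simp add: norm_mult ennreal_mult)
  qed
  also have "\<dots> \<le> sqnorm f"
    by (rule gauss_average_form_le) (use assms in auto)
  finally show ?thesis
    by (simp add: c_def mult_left_mono)
qed

text \<open>Remove the regularising factor of the preceding bound by Fatou's lemma.\<close>

lemma sqnorm_fourier_le:
  assumes f: "integrable lborel f" and "a \<noteq> 0"
  shows "sqnorm (fourier a f) \<le> ennreal (2 * pi / \<bar>a\<bar>) * sqnorm f"
proof -
  have [measurable]: "f \<in> borel_measurable borel"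
    using f by (auto dest!: borel_measurable_integrable)
  let ?W = "\<lambda>n y. ennreal (gauss (\<bar>a\<bar> * (1 / real (Suc n))) y * (cmod (fourier a f y))\<^sup>2)"
  have "(\<lambda>n. ?W n y) \<longlonglongrightarrow> ennreal (1 * (cmod (fourier a f y))\<^sup>2)" for y
    by (intro tendsto_ennrealI tendsto_mult gauss_tendsto_1 tendsto_const)
  from lim_imp_Liminf[OF sequentially_bot this]
  have "sqnorm (fourier a f) = (\<integral>\<^sup>+y. liminf (\<lambda>n. ?W n y) \<partial>lborel)"
    unfolding sqnorm_def by simp
  also have "\<dots> \<le> liminf (\<lambda>n. \<integral>\<^sup>+y. ?W n y \<partial>lborel)"
    by (intro nn_integral_liminf) measurable
  also have "\<dots> \<le> liminf (\<lambda>n::nat. ennreal (2 * pi / \<bar>a\<bar>) * sqnorm f)"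
    using assms by (intro Liminf_mono always_eventually allI weighted_fourier_bound) auto
  also have "\<dots> = ennreal (2 * pi / \<bar>a\<bar>) * sqnorm f"
    by (simp add: Liminf_const)
  finally show ?thesis .
qed

section \<open>The Fourier--Plancherel transform\<close>

lemma sqnorm_dominated_convergence:
  assumes "square_integrable h" and [measurable]: "\<And>n. r n \<in> borel_measurable borel"
    and bound: "\<And>n x. cmod (r n x) \<le> cmod (h x)"
    and lim: "\<And>x. (\<lambda>n. r n x) \<longlonglongrightarrow> 0"
  shows "(\<lambda>n. sqnorm (r n)) \<longlonglongrightarrow> 0"
proof -
  have [measurable]: "h \<in> borel_measurable borel"
    using assms by auto
  have "(\<lambda>n. sqnorm (r n)) \<longlonglongrightarrow> (\<integral>\<^sup>+(x::real). 0 \<partial>lborel)"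
    unfolding sqnorm_def
  proof (rule nn_integral_dominated_convergence[where w = "\<lambda>x. ennreal ((cmod (h x))\<^sup>2)"])
    show "AE x in lborel. (\<lambda>n. ennreal ((cmod (r n x))\<^sup>2)) \<longlonglongrightarrow> 0"
    proof (intro AE_I2)
      fix x
      have "(\<lambda>n. ennreal ((cmod (r n x))\<^sup>2)) \<longlonglongrightarrow> ennreal ((cmod 0)\<^sup>2)"
        by (intro tendsto_intros lim)
      then show "(\<lambda>n. ennreal ((cmod (r n x))\<^sup>2)) \<longlonglongrightarrow> 0"
        by simp
    qed
    show "(\<integral>\<^sup>+x. ennreal ((cmod (h x))\<^sup>2) \<partial>lborel) < \<infinity>"
      using assms(1) by (simp add: square_integrable_def sqnorm_def)
  qed (auto intro!: AE_I2 ennreal_leI power_mono bound)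
  then show ?thesis
    by simp
qed

lemma cutoff_tendsto:
  assumes "filterlim X at_top F"
  shows "((\<lambda>n. f x - cutoff (X n) f x) \<longlongrightarrow> 0) F"
proof (rule tendsto_eventually)
  have "eventually (\<lambda>n. X n \<ge> \<bar>x\<bar>) F"
    using assms by (auto simp: filterlim_at_top)
  then show "eventually (\<lambda>n. f x - cutoff (X n) f x = 0) F"
    by eventually_elim (auto simp: cutoff_def indicator_def)
qed

lemma cutoff_tail_tendsto:
  assumes "square_integrable f"
  shows "((\<lambda>R. sqnorm (\<lambda>x. f x - cutoff R f x)) \<longlongrightarrow> 0) at_top"
proof (rule tendsto_at_topI_sequentially)
  fix X :: "nat \<Rightarrow> real"
  assume X: "filterlim X at_top sequentially"
  have [measurable]: "f \<in> borel_measurable borel"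
    using assms by auto
  show "(\<lambda>n. sqnorm (\<lambda>x. f x - cutoff (X n) f x)) \<longlonglongrightarrow> 0"
  proof (rule sqnorm_dominated_convergence[OF assms])
    show "(\<lambda>n. f x - cutoff (X n) f x) \<longlonglongrightarrow> 0" for x
      by (rule cutoff_tendsto[OF X])
  qed (auto simp: cutoff_def indicator_def)
qed

lemma sqnorm_Fatou:
  assumes [measurable]: "\<And>n. u n \<in> borel_measurable borel"
    and lim: "AE x in lborel. (\<lambda>n. u n x) \<longlonglongrightarrow> v x"
    and bound: "eventually (\<lambda>n. sqnorm (u n) \<le> e) sequentially"
  shows "sqnorm v \<le> e"
proof -
  have "sqnorm v = (\<integral>\<^sup>+x. liminf (\<lambda>n. ennreal ((cmod (u n x))\<^sup>2)) \<partial>lborel)"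
    unfolding sqnorm_def
  proof (rule nn_integral_cong_AE)
    show "AE x in lborel. ennreal ((cmod (v x))\<^sup>2) = liminf (\<lambda>n. ennreal ((cmod (u n x))\<^sup>2))"
      using lim
    proof eventually_elim
      case (elim x)
      then have "(\<lambda>n. ennreal ((cmod (u n x))\<^sup>2)) \<longlonglongrightarrow> ennreal ((cmod (v x))\<^sup>2)"
        by (intro tendsto_intros)
      from lim_imp_Liminf[OF sequentially_bot this] show ?case
        by simp
    qed
  qed
  also have "\<dots> \<le> liminf (\<lambda>n. sqnorm (u n))"
    unfolding sqnorm_def by (intro nn_integral_liminf) measurable
  also have "\<dots> \<le> liminf (\<lambda>n::nat. e)"
    by (intro Liminf_mono bound)
  finally show ?thesis
    by (simp add: Liminf_const)
qed

text \<open>Completeness, with the rate of convergence kept: along a subsequence whose consecutive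
  distances \<open>d k\<close> satisfy \<open>sqnorm (d k) \<le> (1 / 4) ^ k\<close> the functions converge almost
  everywhere, and Fatou's lemma carries the Cauchy estimate over to the limit.\<close>

lemma Riesz_Fischer:
  assumes [measurable]: "\<And>n. f n \<in> borel_measurable borel"
    and cauchy: "\<And>m n. n \<le> m \<Longrightarrow> sqnorm (\<lambda>x. f n x - f m x) \<le> \<epsilon> n"
    and \<epsilon>: "\<epsilon> \<longlonglongrightarrow> 0"
  obtains g where "g \<in> borel_measurable borel" "\<And>n. sqnorm (\<lambda>x. f n x - g x) \<le> \<epsilon> n"
proof -
  have "\<exists>N. \<forall>n\<ge>N. \<epsilon> n < ennreal ((1 / 4) ^ k)" for k
    using order_tendstoD(2)[OF \<epsilon>, of "ennreal ((1 / 4) ^ k)"] by (simp add: eventually_sequentially)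
  then obtain N where N: "\<And>k n. N k \<le> n \<Longrightarrow> \<epsilon> n < ennreal ((1 / 4) ^ k)"
    by metis
  \<comment> \<open>Summing the thresholds makes \<open>r\<close> increasing while \<open>r k\<close> stays beyond both \<open>k\<close> and \<open>N k\<close>.\<close>
  define r where "r k = k + (\<Sum>i\<le>k. N i)" for k
  have r_ge: "k \<le> r k" "N k \<le> r k" "r k \<le> r (Suc k)" for k
    using member_le_sum[of k "{..k}" N] by (auto simp: r_def)
  define d where "d k x = f (r k) x - f (r (Suc k)) x" for k x
  have [measurable]: "d k \<in> borel_measurable borel" for k
    unfolding d_def[abs_def] by measurable
  \<comment> \<open>The weights \<open>2 ^ k\<close> still leave a convergent series of norms and force the \<open>d k x\<close>
    to be summable.\<close>
  have d_small: "sqnorm (d k) \<le> ennreal ((1 / 4) ^ k)" for k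
    unfolding d_def[abs_def] using cauchy[OF r_ge(3)[of k]] N[OF r_ge(2)[of k]] by simp
  have "(\<integral>\<^sup>+x. (\<Sum>k. ennreal (2 ^ k * (cmod (d k x))\<^sup>2)) \<partial>lborel) =
      (\<Sum>k. \<integral>\<^sup>+x. ennreal (2 ^ k * (cmod (d k x))\<^sup>2) \<partial>lborel)"
    by (rule nn_integral_suminf) measurable
  also have "\<dots> = (\<Sum>k. ennreal (2 ^ k) * sqnorm (d k))"
    unfolding sqnorm_def by (simp add: ennreal_mult nn_integral_cmult)
  also have "\<dots> \<le> (\<Sum>k. ennreal ((1 / 2) ^ k))"
  proof (intro suminf_le allI)
    fix k
    have "ennreal (2 ^ k) * sqnorm (d k) \<le> ennreal (2 ^ k) * ennreal ((1 / 4) ^ k)"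
      by (intro mult_left_mono d_small) simp
    also have "\<dots> = ennreal ((2 * (1 / 4)) ^ k)"
      by (simp only: power_mult_distrib ennreal_mult[symmetric] zero_le_power zero_le_numeral zero_le_divide_1_iff)
    finally show "ennreal (2 ^ k) * sqnorm (d k) \<le> ennreal ((1 / 2) ^ k)"
      by simp
  qed auto
  also have "\<dots> = ennreal (\<Sum>k. (1 / 2) ^ k)"
    by (intro suminf_ennreal2) (auto intro: summable_geometric)
  also have "\<dots> < \<infinity>"
    by simp
  finally have "AE x in lborel. (\<Sum>k. ennreal (2 ^ k * (cmod (d k x))\<^sup>2)) \<noteq> \<infinity>"
    by (intro nn_integral_noteq_infinite) auto
  then have conv: "AE x in lborel. convergent (\<lambda>k. f (r k) x)"
  proof eventually_elim
    case (elim x)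
    then have "summable (\<lambda>k. 2 ^ k * (cmod (d k x))\<^sup>2)"
      by (intro summable_suminf_not_top) auto
    moreover have "summable (\<lambda>k. (1 / 2 :: real) ^ k)"
      by (intro summable_geometric) simp
    ultimately have "summable (\<lambda>k. 2 ^ k * (cmod (d k x))\<^sup>2 + (1 / 2) ^ k)"
      by (rule summable_add)
    then have "summable (\<lambda>k. d k x)"
    proof (rule summable_comparison_test')
      fix k :: nat
      \<comment> \<open>The mean inequality for \<open>2 ^ k * \<bar>d\<bar>\<^sup>2\<close> and \<open>(1 / 2) ^ k\<close>, written as a square.\<close>
      have "0 \<le> (2 ^ k * cmod (d k x) - 1)\<^sup>2 / 2 ^ k"
        by simp
      also have "\<dots> = 2 ^ k * (cmod (d k x))\<^sup>2 + (1 / 2) ^ k - 2 * cmod (d k x)"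
        by (simp add: power2_diff power_mult_distrib field_simps power2_eq_square)
      finally show "norm (d k x) \<le> 2 ^ k * (cmod (d k x))\<^sup>2 + (1 / 2) ^ k"
        using norm_ge_zero[of "d k x"] by linarith
    qed
    then have "convergent (\<lambda>n. f (r 0) x - (\<Sum>k<n. d k x))"
      unfolding summable_iff_convergent by (intro convergent_diff convergent_const)
    moreover have "f (r 0) x - (\<Sum>k<n. d k x) = f (r n) x" for n
      unfolding d_def by (subst sum_lessThan_telescope') simp
    ultimately show "convergent (\<lambda>k. f (r k) x)"
      by simp
  qed
  define g where "g x = lim (\<lambda>k. f (r k) x)" for x
  have [measurable]: "g \<in> borel_measurable borel"
    unfolding g_def[abs_def] by measurable
  have "sqnorm (\<lambda>x. f n x - g x) \<le> \<epsilon> n" for n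
  proof (rule sqnorm_Fatou[where u = "\<lambda>k x. f n x - f (r k) x"])
    show "AE x in lborel. (\<lambda>k. f n x - f (r k) x) \<longlonglongrightarrow> f n x - g x"
      using conv unfolding g_def by eventually_elim (intro tendsto_intros, simp add: convergent_LIMSEQ_iff)
    have "sqnorm (\<lambda>x. f n x - f (r k) x) \<le> \<epsilon> n" if "k \<ge> n" for k
      using r_ge(1)[of k] that by (intro cauchy) simp
    then show "eventually (\<lambda>k. sqnorm (\<lambda>x. f n x - f (r k) x) \<le> \<epsilon> n) sequentially"
      by (auto simp: eventually_sequentially)
  qed measurable
  then show thesis
    by (rule that[rotated]) simp
qed

text \<open>\<open>g\<close> is the Fourier transform of \<open>f\<close> in the mean. As a relation it determines \<open>g\<close> only up
  to a null set, which matches the equivalence classes in the final statement.\<close>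

definition plancherel :: "real \<Rightarrow> (real \<Rightarrow> complex) \<Rightarrow> (real \<Rightarrow> complex) \<Rightarrow> bool" where
  "plancherel a f g \<longleftrightarrow> square_integrable f \<and> square_integrable g \<and>
    ((\<lambda>R. sqnorm (\<lambda>y. fourier a (cutoff R f) y - g y)) \<longlongrightarrow> 0) at_top"

lemma square_integrable_fourier:
  assumes "integrable lborel f" "square_integrable f" "a \<noteq> 0"
  shows "square_integrable (fourier a f)"
proof -
  have "sqnorm (fourier a f) \<le> ennreal (2 * pi / \<bar>a\<bar>) * sqnorm f"
    using assms by (intro sqnorm_fourier_le)
  also have "\<dots> < \<infinity>"
    using assms by (simp add: square_integrable_def ennreal_mult_less_top)
  finally show ?thesis
    using assms by (auto simp: square_integrable_def)
qed

lemma sqnorm_fourier_diff_le: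
  assumes "integrable lborel f" "integrable lborel g" "a \<noteq> 0"
  shows "sqnorm (\<lambda>y. fourier a f y - fourier a g y) \<le> ennreal (2 * pi / \<bar>a\<bar>) * sqnorm (\<lambda>x. f x - g x)"
proof -
  have "fourier a (\<lambda>x. f x - g x) = (\<lambda>y. fourier a f y - fourier a g y)"
    using assms by (intro ext fourier_diff)
  then show ?thesis
    using sqnorm_fourier_le[of "\<lambda>x. f x - g x" a] assms by simp
qed

lemma sqnorm_cutoff_diff_le:
  "R \<le> S \<Longrightarrow> sqnorm (\<lambda>x. cutoff R f x - cutoff S f x) \<le> sqnorm (\<lambda>x. f x - cutoff R f x)"
  by (intro sqnorm_mono) (auto simp: cutoff_def indicator_def)

lemma tendsto_0_cmult_ennreal:
  fixes u :: "'b \<Rightarrow> ennreal"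
  assumes "(u \<longlongrightarrow> 0) F" "c < \<infinity>"
  shows "((\<lambda>x. c * u x) \<longlongrightarrow> 0) F"
  using ennreal_tendsto_cmult[OF _ assms(1), of c] assms(2) by simp

lemma tendsto_0_double_sum:
  fixes u v :: "'b \<Rightarrow> ennreal"
  assumes "(u \<longlongrightarrow> 0) F" "(v \<longlongrightarrow> 0) F"
  shows "((\<lambda>x. 2 * u x + 2 * v x) \<longlongrightarrow> 0) F"
  using tendsto_add[OF tendsto_0_cmult_ennreal[OF assms(1), of 2] tendsto_0_cmult_ennreal[OF assms(2), of 2]]
  by simp

lemma tendsto_0_le_ennreal:
  fixes u v :: "'b \<Rightarrow> ennreal"
  assumes "(v \<longlongrightarrow> 0) F" "\<And>x. u x \<le> v x"
  shows "(u \<longlongrightarrow> 0) F"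
  by (rule tendsto_sandwich[OF _ _ tendsto_const assms(1)]) (auto simp: assms(2))

text \<open>The Gaussian bound turns the vanishing tails of \<open>f\<close> into a Cauchy estimate for the transforms
  of its cutoffs. Completeness gives a limit along the integers; since the tails decrease, the
  same estimate controls all real cutoffs.\<close>

lemma plancherel_exists:
  assumes f: "square_integrable f" and a: "a \<noteq> 0"
  obtains g where "plancherel a f g"
proof -
  have [measurable]: "f \<in> borel_measurable borel"
    using f by auto
  define T where "T R = fourier a (cutoff R f)" for R
  have [measurable]: "T R \<in> borel_measurable borel" for R
    unfolding T_def by measurable
  define tail where "tail R = ennreal (2 * pi / \<bar>a\<bar>) * sqnorm (\<lambda>x. f x - cutoff R f x)" for R
  have tail: "(tail \<longlongrightarrow> 0) at_top"
    unfolding tail_def[abs_def] by (intro tendsto_0_cmult_ennreal cutoff_tail_tendsto f) simp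
  have T: "sqnorm (\<lambda>y. T R y - T S y) \<le> tail R" if "R \<le> S" for R S
  proof -
    have "sqnorm (\<lambda>y. T R y - T S y) \<le> ennreal (2 * pi / \<bar>a\<bar>) * sqnorm (\<lambda>x. cutoff R f x - cutoff S f x)"
      unfolding T_def by (intro sqnorm_fourier_diff_le integrable_cutoff f a)
    also have "\<dots> \<le> tail R"
      unfolding tail_def using that by (intro mult_left_mono sqnorm_cutoff_diff_le) auto
    finally show ?thesis .
  qed
  obtain g where [measurable]: "g \<in> borel_measurable borel"
    and g: "\<And>n. sqnorm (\<lambda>y. T (real n) y - g y) \<le> tail (real n)"
  proof (rule Riesz_Fischer[where f = "\<lambda>n. T (real n)" and \<epsilon> = "\<lambda>n. tail (real n)"])
    show "(\<lambda>n. tail (real n)) \<longlonglongrightarrow> 0"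
      by (rule filterlim_compose[OF tail filterlim_real_sequentially])
  qed (auto intro: T)
  have bound: "sqnorm (\<lambda>y. T R y - g y) \<le> 2 * tail R + 2 * tail R" for R
  proof -
    define n where "n = nat \<lceil>R\<rceil>"
    have n: "R \<le> real n"
      by (simp add: n_def of_nat_ceiling)
    have "sqnorm (\<lambda>y. T R y - g y) \<le> 2 * sqnorm (\<lambda>y. T R y - T n y) + 2 * sqnorm (\<lambda>y. T n y - g y)"
      by (rule sqnorm_triangle) auto
    also have "\<dots> \<le> 2 * tail R + 2 * tail (real n)"
      by (intro add_mono mult_left_mono T[OF n] g) auto
    also have "\<dots> \<le> 2 * tail R + 2 * tail R"
      unfolding tail_def using n
      by (intro add_mono mult_left_mono sqnorm_mono) (auto simp: cutoff_def indicator_def)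
    finally show ?thesis .
  qed
  have lim: "((\<lambda>R. sqnorm (\<lambda>y. T R y - g y)) \<longlongrightarrow> 0) at_top"
    by (rule tendsto_0_le_ennreal[OF tendsto_0_double_sum[OF tail tail] bound])
  have "eventually (\<lambda>R. sqnorm (\<lambda>y. T R y - g y) < 1) at_top"
    by (rule order_tendstoD(2)[OF lim]) simp
  then obtain R where "sqnorm (\<lambda>y. T R y - g y) < 1"
    unfolding eventually_at_top_linorder by blast
  moreover have "square_integrable (T R)"
    unfolding T_def by (intro square_integrable_fourier integrable_cutoff square_integrable_cutoff f a)
  ultimately have "square_integrable g"
    by (intro square_integrable_limit[of "T R" g]) (auto elim: order.strict_trans)
  with f lim have "plancherel a f g"
    by (simp add: plancherel_def T_def)
  with that show thesis .
qed

section \<open>Fourier inversion in the mean\<close>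

lemma plancherel_square_integrable:
  assumes "plancherel a f g"
  shows "square_integrable f" "square_integrable g"
  using assms by (simp_all add: plancherel_def)

lemma plancherel_bound:
  assumes fg: "plancherel a f g" and a: "a \<noteq> 0"
  shows "sqnorm g \<le> 2 * (ennreal (2 * pi / \<bar>a\<bar>) * sqnorm f)"
proof (rule tendsto_lowerbound)
  note f = plancherel_square_integrable(1)[OF fg] and g = plancherel_square_integrable(2)[OF fg]
  have [measurable]: "f \<in> borel_measurable borel" "g \<in> borel_measurable borel"
    using f g by auto
  let ?T = "\<lambda>R. fourier a (cutoff R f)"
  have "((\<lambda>R. 2 * sqnorm (\<lambda>y. ?T R y - g y)) \<longlongrightarrow> 0) at_top"
    using fg by (intro tendsto_0_cmult_ennreal) (auto simp: plancherel_def)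
  from tendsto_add[OF this tendsto_const[of "2 * (ennreal (2 * pi / \<bar>a\<bar>) * sqnorm f)"]]
  show "((\<lambda>R. 2 * sqnorm (\<lambda>y. ?T R y - g y) + 2 * (ennreal (2 * pi / \<bar>a\<bar>) * sqnorm f)) \<longlongrightarrow>
      2 * (ennreal (2 * pi / \<bar>a\<bar>) * sqnorm f)) at_top"
    by simp
  have "sqnorm g \<le> 2 * sqnorm (\<lambda>y. ?T R y - g y) + 2 * (ennreal (2 * pi / \<bar>a\<bar>) * sqnorm f)" for R
  proof -
    have "sqnorm g \<le> 2 * sqnorm (\<lambda>y. g y - ?T R y) + 2 * sqnorm (?T R)"
      using sqnorm_triangle[of g "?T R" "\<lambda>_. 0"] by simp
    also have "sqnorm (?T R) \<le> ennreal (2 * pi / \<bar>a\<bar>) * sqnorm (cutoff R f)"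
      by (intro sqnorm_fourier_le integrable_cutoff f a)
    also have "sqnorm (cutoff R f) \<le> sqnorm f"
      by (intro sqnorm_mono) (auto simp: cutoff_def indicator_def)
    finally show ?thesis
      by (simp add: sqnorm_minus_commute[of g "?T R"] mult_left_mono)
  qed
  then show "\<forall>\<^sub>F R in at_top. sqnorm g \<le> 2 * sqnorm (\<lambda>y. ?T R y - g y) + 2 * (ennreal (2 * pi / \<bar>a\<bar>) * sqnorm f)"
    by simp
qed simp

lemma plancherel_diff:
  assumes "plancherel a f g" "plancherel a f' g'"
  shows "plancherel a (\<lambda>x. f x - f' x) (\<lambda>y. g y - g' y)"
proof -
  note sq = assms[THEN plancherel_square_integrable(1)] assms[THEN plancherel_square_integrable(2)]
  have [measurable]: "f \<in> borel_measurable borel" "g \<in> borel_measurable borel"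
    "f' \<in> borel_measurable borel" "g' \<in> borel_measurable borel"
    using sq by auto
  have eq: "fourier a (cutoff R (\<lambda>x. f x - f' x)) y = fourier a (cutoff R f) y - fourier a (cutoff R f') y" for R y
  proof -
    have "cutoff R (\<lambda>x. f x - f' x) = (\<lambda>x. cutoff R f x - cutoff R f' x)"
      by (auto simp: cutoff_def right_diff_distrib)
    then show ?thesis
      using sq by (simp add: fourier_diff integrable_cutoff)
  qed
  have bound: "sqnorm (\<lambda>y. fourier a (cutoff R (\<lambda>x. f x - f' x)) y - (g y - g' y)) \<le>
      2 * sqnorm (\<lambda>y. fourier a (cutoff R f) y - g y) + 2 * sqnorm (\<lambda>y. fourier a (cutoff R f') y - g' y)" for R
  proof -
    have split: "fourier a (cutoff R (\<lambda>x. f x - f' x)) y - (g y - g' y) =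
        (fourier a (cutoff R f) y - g y) + (g' y - fourier a (cutoff R f') y)" for y
      by (simp add: eq)
    have "sqnorm (\<lambda>y. (fourier a (cutoff R f) y - g y) + (g' y - fourier a (cutoff R f') y)) \<le>
        2 * sqnorm (\<lambda>y. fourier a (cutoff R f) y - g y) + 2 * sqnorm (\<lambda>y. g' y - fourier a (cutoff R f') y)"
      by (rule sqnorm_add) auto
    also have "sqnorm (\<lambda>y. g' y - fourier a (cutoff R f') y) = sqnorm (\<lambda>y. fourier a (cutoff R f') y - g' y)"
      by (rule sqnorm_minus_commute)
    finally show ?thesis
      by (simp only: split)
  qed
  have "((\<lambda>R. sqnorm (\<lambda>y. fourier a (cutoff R (\<lambda>x. f x - f' x)) y - (g y - g' y))) \<longlongrightarrow> 0) at_top"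
  proof (rule tendsto_0_le_ennreal[OF _ bound])
    show "((\<lambda>R. 2 * sqnorm (\<lambda>y. fourier a (cutoff R f) y - g y) +
        2 * sqnorm (\<lambda>y. fourier a (cutoff R f') y - g' y)) \<longlongrightarrow> 0) at_top"
      using assms by (intro tendsto_0_double_sum) (auto simp: plancherel_def)
  qed
  then show ?thesis
    using sq by (simp add: plancherel_def square_integrable_diff)
qed

lemma plancherel_cmult:
  assumes "plancherel a f g"
  shows "plancherel a (\<lambda>x. c * f x) (\<lambda>y. c * g y)"
proof -
  note sq = assms[THEN plancherel_square_integrable(1)] assms[THEN plancherel_square_integrable(2)]
  have [measurable]: "f \<in> borel_measurable borel" "g \<in> borel_measurable borel"
    using sq by auto
  have "cutoff R (\<lambda>x. c * f x) = (\<lambda>x. c * cutoff R f x)" for R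
    by (auto simp: cutoff_def)
  then have "sqnorm (\<lambda>y. fourier a (cutoff R (\<lambda>x. c * f x)) y - c * g y) =
      ennreal ((cmod c)\<^sup>2) * sqnorm (\<lambda>y. fourier a (cutoff R f) y - g y)" for R
    by (subst sqnorm_cmult[symmetric]) (auto simp: fourier_cmult right_diff_distrib)
  moreover have "((\<lambda>R. ennreal ((cmod c)\<^sup>2) * sqnorm (\<lambda>y. fourier a (cutoff R f) y - g y)) \<longlongrightarrow> 0) at_top"
    using assms by (intro tendsto_0_cmult_ennreal) (auto simp: plancherel_def)
  ultimately show ?thesis
    using sq by (simp add: plancherel_def square_integrable_cmult)
qed

text \<open>Continuity in the mean: a transform can be computed along any approximating sequence, in
  particular along the Gaussian regularisations used for the inversion formula.\<close>

lemma plancherel_continuous: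
  assumes "plancherel a f g" "\<And>n. plancherel a (F n) (G n)" "a \<noteq> 0"
    and "(\<lambda>n. sqnorm (\<lambda>x. f x - F n x)) \<longlonglongrightarrow> 0"
  shows "(\<lambda>n. sqnorm (\<lambda>x. g x - G n x)) \<longlonglongrightarrow> 0"
proof (rule tendsto_0_le_ennreal)
  show "(\<lambda>n. 2 * (ennreal (2 * pi / \<bar>a\<bar>) * sqnorm (\<lambda>x. f x - F n x))) \<longlonglongrightarrow> 0"
    using assms(4) by (intro tendsto_0_cmult_ennreal) auto
qed (intro plancherel_bound plancherel_diff assms)

lemma plancherel_integrable:
  assumes "integrable lborel f" "square_integrable f" "a \<noteq> 0"
  shows "plancherel a f (fourier a f)"
proof -
  have "((\<lambda>R. sqnorm (\<lambda>y. fourier a (cutoff R f) y - fourier a f y)) \<longlongrightarrow> 0) at_top"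
  proof (rule tendsto_0_le_ennreal)
    show "((\<lambda>R. ennreal (2 * pi / \<bar>a\<bar>) * sqnorm (\<lambda>x. f x - cutoff R f x)) \<longlongrightarrow> 0) at_top"
      by (intro tendsto_0_cmult_ennreal cutoff_tail_tendsto assms) simp
    show "sqnorm (\<lambda>y. fourier a (cutoff R f) y - fourier a f y) \<le>
        ennreal (2 * pi / \<bar>a\<bar>) * sqnorm (\<lambda>x. f x - cutoff R f x)" for R
      using sqnorm_fourier_diff_le[of "cutoff R f" f a] assms
      by (simp add: integrable_cutoff sqnorm_minus_commute[of f "cutoff R f"])
  qed
  then show ?thesis
    using assms by (simp add: plancherel_def square_integrable_fourier)
qed

text \<open>After the substitution \<open>x = u + s * v\<close> the integrand converges for every \<open>v\<close>, because
  \<open>u\<close> is not an endpoint of the interval.\<close>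

lemma normal_mass_interval_tendsto:
  assumes "u \<noteq> a" "u \<noteq> b"
  shows "(\<lambda>n. \<integral>x. indicator {a..b} x * normal_density u (1 / real (Suc n)) x \<partial>lborel) \<longlonglongrightarrow> indicator {a..b} u"
proof -
  have eq: "(\<integral>x. indicator {a..b} x * normal_density u s x \<partial>lborel) =
      (\<integral>v. indicator {a..b} (u + s * v) * std_normal_density v \<partial>lborel)" if "s > 0" for s :: real
  proof -
    have "(\<integral>x. indicator {a..b} x * normal_density u s x \<partial>lborel) =
        \<bar>s\<bar> *\<^sub>R (\<integral>v. indicator {a..b} (u + s * v) * normal_density u s (u + s * v) \<partial>lborel)"
      using that by (intro lborel_integral_real_affine) simp
    also have "\<dots> = (\<integral>v. \<bar>s\<bar> * (indicator {a..b} (u + s * v) * normal_density u s (u + s * v)) \<partial>lborel)"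
      by simp
    also have "\<dots> = (\<integral>v. indicator {a..b} (u + s * v) * std_normal_density v \<partial>lborel)"
      using that by (intro Bochner_Integration.integral_cong)
        (simp_all add: normal_density_def real_sqrt_mult power_mult_distrib)
    finally show ?thesis .
  qed
  have "(\<lambda>n. \<integral>v. indicator {a..b} (u + 1 / real (Suc n) * v) * std_normal_density v \<partial>lborel) \<longlonglongrightarrow>
      (\<integral>v. indicator {a..b} u * std_normal_density v \<partial>lborel)"
  proof (rule integral_dominated_convergence[where w = std_normal_density])
    show "AE v in lborel. (\<lambda>n. indicator {a..b} (u + 1 / real (Suc n) * v) * std_normal_density v) \<longlonglongrightarrow>
        indicator {a..b} u * std_normal_density v"
    proof (intro AE_I2 tendsto_mult tendsto_const tendsto_eventually)
      fix v
      have "(\<lambda>n. u + 1 / real (Suc n) * v) \<longlonglongrightarrow> u + 0 * v"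
        by (intro tendsto_intros LIMSEQ_inverse_real_of_nat[unfolded inverse_eq_divide])
      then have lim: "(\<lambda>n. u + 1 / real (Suc n) * v) \<longlonglongrightarrow> u"
        by simp
      show "\<forall>\<^sub>F n in sequentially. indicator {a..b} (u + 1 / real (Suc n) * v) = (indicator {a..b} u :: real)"
      proof (cases "u \<in> {a..b}")
        case True
        with assms have "u \<in> {a<..<b}"
          by auto
        with topological_tendstoD[OF lim, of "{a<..<b}"] True show ?thesis
          by (auto elim!: eventually_mono simp: indicator_def)
      next
        case False
        then have "u \<in> - {a..b}"
          by auto
        with topological_tendstoD[OF lim, of "- {a..b}"] False show ?thesis
          by (auto elim!: eventually_mono simp: indicator_def)
      qed
    qed
  qed (auto simp: indicator_def)
  then show ?thesis
    by (simp add: eq)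
qed

lemma integrable_interval_indicator: "integrable lborel (indicator {a..b::real} :: real \<Rightarrow> complex)"
proof -
  have eq: "(indicator {a..b} :: real \<Rightarrow> complex) = (\<lambda>x. complex_of_real (indicator {a..b} x))"
    by (auto simp: indicator_def)
  show ?thesis
    unfolding eq by (intro integrable_of_real integrable_real_indicator) (auto simp: emeasure_lborel_Icc_eq)
qed

lemma integral_gauss_average_interval:
  assumes f: "integrable lborel f" and s: "s > 0"
  shows "(\<integral>x. indicator {a..b} x * gauss_average s f x \<partial>lborel) =
    (\<integral>u. f u * complex_of_real (\<integral>x. indicator {a..b} x * normal_density u s x \<partial>lborel) \<partial>lborel)"
proof -
  have "integrable (lborel \<Otimes>\<^sub>M lborel) (\<lambda>(u, x). f u * indicator {a..b} x * complex_of_real (normal_density x s u))"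
  proof (rule integrable_product_kernel[OF f integrable_interval_indicator])
    show "cmod (complex_of_real (normal_density x s u)) \<le> 1 / sqrt (2 * pi * s\<^sup>2)" for x u
      unfolding norm_of_real using s by (simp add: normal_density_def divide_right_mono)
    show "(\<lambda>(u, x). complex_of_real (normal_density x s u)) \<in> borel_measurable (borel \<Otimes>\<^sub>M borel)"
      unfolding normal_density_def by measurable
  qed
  note Fub = lborel_pair.Fubini_integral[OF this]
  have "(\<integral>x. indicator {a..b} x * gauss_average s f x \<partial>lborel) =
      (\<integral>x. (\<integral>u. f u * indicator {a..b} x * complex_of_real (normal_density x s u) \<partial>lborel) \<partial>lborel)"
    unfolding gauss_average_def integral_mult_right_zero[symmetric]
      mult.assoc mult.left_commute[of "indicator {a..b} _" "f _"] ..
  also have "\<dots> = (\<integral>u. (\<integral>x. f u * indicator {a..b} x * complex_of_real (normal_density x s u) \<partial>lborel) \<partial>lborel)"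
    by (rule Fub)
  also have "\<dots> = (\<integral>u. f u * complex_of_real (\<integral>x. indicator {a..b} x * normal_density u s x \<partial>lborel) \<partial>lborel)"
  proof (intro Bochner_Integration.integral_cong refl)
    fix u
    have nd: "complex_of_real (indicator {a..b} x * normal_density u s x) =
        indicator {a..b} x * complex_of_real (normal_density x s u)" for x
      by (cases "x \<in> {a..b}") (simp_all add: normal_density_swap[of u s x])
    have e: "complex_of_real (\<integral>x. indicator {a..b} x * normal_density u s x \<partial>lborel) =
        (\<integral>x. indicator {a..b} x * complex_of_real (normal_density x s u) \<partial>lborel)"
      unfolding nd[symmetric] by (rule integral_complex_of_real[symmetric])
    show "(\<integral>x. f u * indicator {a..b} x * complex_of_real (normal_density x s u) \<partial>lborel) =
        f u * complex_of_real (\<integral>x. indicator {a..b} x * normal_density u s x \<partial>lborel)"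
      unfolding e mult.assoc by (rule integral_mult_right_zero)
  qed
  finally show ?thesis .
qed

text \<open>Averages converge weakly to the function: by symmetry of the kernel the average can be moved
  to the indicator of the interval, where pointwise convergence is elementary.\<close>

lemma integral_gauss_average_interval_tendsto:
  assumes f: "integrable lborel f"
  shows "(\<lambda>n. \<integral>x. indicator {a..b} x * gauss_average (1 / real (Suc n)) f x \<partial>lborel) \<longlonglongrightarrow>
    (\<integral>x. indicator {a..b} x * f x \<partial>lborel)"
proof -
  have [measurable]: "f \<in> borel_measurable borel"
    using f by (auto dest!: borel_measurable_integrable)
  define m where "m n u = (\<integral>x. indicator {a..b} x * normal_density u (1 / real (Suc n)) x \<partial>lborel)" for n u
  have [measurable]: "m n \<in> borel_measurable borel" for n
    unfolding m_def[abs_def] normal_density_def by measurable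
  have m: "cmod (complex_of_real (m n u)) \<le> 1" for n u
  proof -
    have "norm (m n u) \<le> (\<integral>x. norm (indicator {a..b} x * normal_density u (1 / real (Suc n)) x) \<partial>lborel)"
      unfolding m_def by (rule integral_norm_bound)
    also have "\<dots> \<le> (\<integral>x. normal_density u (1 / real (Suc n)) x \<partial>lborel)"
      by (intro integral_mono_AE' integrable_normal_density AE_I2) (auto simp: indicator_def)
    also have "\<dots> = 1"
      by (intro integral_normal_density) simp
    finally show ?thesis
      by simp
  qed
  have "(\<lambda>n. \<integral>u. f u * complex_of_real (m n u) \<partial>lborel) \<longlonglongrightarrow> (\<integral>u. f u * complex_of_real (indicator {a..b} u) \<partial>lborel)"
  proof (rule integral_dominated_convergence[where w = "\<lambda>u. norm (f u)"])
    have "AE u in lborel. u \<noteq> a" "AE u in lborel. u \<noteq> b"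
      by (rule AE_lborel_singleton)+
    then show "AE u in lborel. (\<lambda>n. f u * complex_of_real (m n u)) \<longlonglongrightarrow> f u * complex_of_real (indicator {a..b} u)"
    proof eventually_elim
      case (elim u)
      then show ?case
        unfolding m_def by (intro tendsto_intros normal_mass_interval_tendsto)
    qed
    show "AE u in lborel. norm (f u * complex_of_real (m n u)) \<le> norm (f u)" for n
      using m[of n] by (intro AE_I2) (simp add: norm_mult mult_left_le)
  qed (use f in auto)
  moreover have "f u * complex_of_real (indicator {a..b} u) = indicator {a..b} u * f u" for u
    by (simp add: indicator_def)
  ultimately show ?thesis
    by (simp add: integral_gauss_average_interval[OF f] m_def)
qed

text \<open>Lebesgue differentiation: outside a null set \<open>f x\<close> is the limit of the means of \<open>f\<close> over the
  intervals \<open>{x..x + h}\<close>.\<close>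

lemma zero_if_interval_integrals_zero:
  assumes f: "square_integrable f" and zero: "\<And>a b. (\<integral>x. indicator {a..b} x * f x \<partial>lborel) = 0"
  shows "AE x in lborel. f x = 0"
proof -
  have [measurable]: "f \<in> borel_measurable borel"
    using f by auto
  have ind: "(\<lambda>x. indicator {a..b} x *\<^sub>R f x) = (\<lambda>x. indicator {a..b} x * f x)" for a b :: real
    by (auto simp: indicator_def)
  have int: "set_integrable lborel {a..b} f" for a b
    unfolding set_integrable_def ind by (rule square_integrable_mult_integrable[OF square_integrable_indicator f])
  have lint: "(LINT x:{a..b}|lborel. f x) = 0" for a b
    unfolding set_lebesgue_integral_def ind by (rule zero)
  have hk: "f integrable_on {a..b}" "integral {a..b} f = 0" for a b
    using set_borel_integral_eq_integral[OF int[of a b]] lint[of a b] by simp_all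
  obtain N where N: "negligible N" and lim: "\<And>x e. \<lbrakk>x \<notin> N; 0 < e\<rbrakk> \<Longrightarrow>
      \<exists>d>0. \<forall>h. 0 < h \<and> h < d \<longrightarrow>
        norm (integral (cbox x (x + h *\<^sub>R One)) f /\<^sub>R h ^ DIM(real) - f x) < e"
    by (rule integrable_ccontinuous_explicit[of f]) (auto simp: hk)
  have "f x = 0" if "x \<notin> N" for x
  proof (rule ccontr)
    assume "f x \<noteq> 0"
    then obtain d where "d > 0" and d: "\<And>h. 0 < h \<Longrightarrow> h < d \<Longrightarrow>
        norm (integral (cbox x (x + h *\<^sub>R One)) f /\<^sub>R h ^ DIM(real) - f x) < norm (f x)"
      using lim[OF \<open>x \<notin> N\<close>, of "norm (f x)"] by auto
    from d[of "d / 2"] \<open>d > 0\<close> show False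
      by (simp add: hk)
  qed
  then have "negligible {x. f x \<noteq> 0}"
    by (intro negligible_subset[OF N]) auto
  moreover have "{x. f x \<noteq> 0} \<in> sets borel"
    by measurable
  ultimately have "{x. f x \<noteq> 0} \<in> null_sets lborel"
    by (auto simp: negligible_iff_null_sets null_sets_def)
  then show ?thesis
    by (rule AE_I') auto
qed

text \<open>The regularisations \<open>w n * F\<close> of the transform \<open>F\<close> of \<open>f\<close> converge to \<open>F\<close> in the mean, and their
  inverse transforms are multiples of Gaussian averages of \<open>f\<close>. These converge to \<open>k\<close> in the
  mean by continuity and to a multiple of \<open>f\<close> when integrated over intervals, so the two limits
  agree almost everywhere.\<close>

lemma plancherel_inversion_integrable:
  assumes f: "integrable lborel f" "square_integrable f" and a: "a \<noteq> 0"
    and k: "plancherel (- a) (fourier a f) k"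
  shows "AE x in lborel. k x = complex_of_real (2 * pi / \<bar>a\<bar>) * f x"
proof -
  define c where "c = complex_of_real (2 * pi / \<bar>a\<bar>)"
  define w where "w n y = complex_of_real (gauss (\<bar>a\<bar> * (1 / real (Suc n))) y)" for n y
  define F where "F = fourier a f"
  have F: "square_integrable F"
    unfolding F_def by (intro square_integrable_fourier f a)
  have ks: "square_integrable k"
    using k by (rule plancherel_square_integrable)
  have [measurable]: "f \<in> borel_measurable borel" "F \<in> borel_measurable borel"
    "k \<in> borel_measurable borel" "w n \<in> borel_measurable borel" for n
    using f F ks unfolding w_def[abs_def] by auto
  have w: "cmod (w n y) \<le> 1" "cmod (1 - w n y) \<le> 1" for n y
  proof -
    show "cmod (w n y) \<le> 1"
      using gauss_pos gauss_le_1 by (simp add: w_def less_imp_le)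
    have "1 - w n y = complex_of_real (1 - gauss (\<bar>a\<bar> * (1 / real (Suc n))) y)"
      by (simp add: w_def)
    then show "cmod (1 - w n y) \<le> 1"
      using gauss_pos[THEN less_imp_le] gauss_le_1 by (simp only: norm_of_real) simp
  qed
  have wF: "square_integrable (\<lambda>y. w n y * F y)" for n
    using w by (intro square_integrable_dominated[OF F]) (auto simp: norm_mult mult_left_le_one_le)
  have wF_int: "integrable lborel (\<lambda>y. w n y * F y)" for n
    unfolding w_def F_def using f a by (intro integrable_gauss_fourier) auto
  have pn: "plancherel (- a) (\<lambda>y. w n y * F y) (\<lambda>x. c * gauss_average (1 / real (Suc n)) f x)" for n
  proof -
    have "fourier (- a) (\<lambda>y. w n y * F y) = (\<lambda>x. c * gauss_average (1 / real (Suc n)) f x)"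
      unfolding w_def F_def c_def using a by (intro ext fourier_regularised_inversion f) auto
    then show ?thesis
      using plancherel_integrable[OF wF_int wF, of "- a" n] a by simp
  qed
  have "(\<lambda>n. sqnorm (\<lambda>y. F y - w n y * F y)) \<longlonglongrightarrow> 0"
  proof (rule sqnorm_dominated_convergence[OF F])
    show "cmod (F y - w n y * F y) \<le> cmod (F y)" for n y
    proof -
      have "F y - w n y * F y = (1 - w n y) * F y"
        by (simp add: left_diff_distrib)
      then show ?thesis
        using w(2)[of n y] by (simp add: norm_mult mult_left_le_one_le)
    qed
    show "(\<lambda>n. F y - w n y * F y) \<longlonglongrightarrow> 0" for y
    proof -
      have "(\<lambda>n. F y - w n y * F y) \<longlonglongrightarrow> F y - complex_of_real 1 * F y"
        unfolding w_def by (intro tendsto_intros gauss_tendsto_1)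
      then show ?thesis
        by simp
    qed
  qed measurable
  then have lim: "(\<lambda>n. sqnorm (\<lambda>x. k x - c * gauss_average (1 / real (Suc n)) f x)) \<longlonglongrightarrow> 0"
    using a k pn by (intro plancherel_continuous[of "- a" F k]) (auto simp: F_def)
  have sm: "square_integrable (\<lambda>x. c * gauss_average (1 / real (Suc n)) f x)" for n
    using pn by (rule plancherel_square_integrable)
  have "AE x in lborel. k x - c * f x = 0"
  proof (rule zero_if_interval_integrals_zero)
    show "square_integrable (\<lambda>x. k x - c * f x)"
      by (intro square_integrable_diff square_integrable_cmult ks f)
    fix \<alpha> \<beta> :: real
    let ?I = "\<lambda>g :: real \<Rightarrow> complex. \<integral>x. indicator {\<alpha>..\<beta>} x * g x \<partial>lborel"
    have I_diff: "?I (\<lambda>x. g x - h x) = ?I g - ?I h" if "square_integrable g" "square_integrable h" for g h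
      using that by (simp add: right_diff_distrib square_integrable_mult_integrable square_integrable_indicator)
    have I_c: "?I (\<lambda>x. c * g x) = c * ?I g" for g
      by (simp add: mult.left_commute)
    have "(\<lambda>n. ennreal ((cmod (?I (\<lambda>x. k x - c * gauss_average (1 / real (Suc n)) f x)))\<^sup>2)) \<longlonglongrightarrow> 0"
    proof (rule tendsto_0_le_ennreal)
      show "(\<lambda>n. emeasure lborel {\<alpha>..\<beta>} * sqnorm (\<lambda>x. k x - c * gauss_average (1 / real (Suc n)) f x)) \<longlonglongrightarrow> 0"
        by (intro tendsto_0_cmult_ennreal lim) (simp add: emeasure_lborel_Icc_eq)
    qed (intro norm_integral_interval_le square_integrable_diff ks sm)
    then have "(\<lambda>n. (cmod (?I (\<lambda>x. k x - c * gauss_average (1 / real (Suc n)) f x)))\<^sup>2) \<longlonglongrightarrow> 0"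
      by (subst (asm) ennreal_0[symmetric], subst (asm) tendsto_ennreal_iff) auto
    then have "(\<lambda>n. sqrt ((cmod (?I (\<lambda>x. k x - c * gauss_average (1 / real (Suc n)) f x)))\<^sup>2)) \<longlonglongrightarrow> sqrt 0"
      by (rule tendsto_real_sqrt)
    then have "(\<lambda>n. ?I (\<lambda>x. k x - c * gauss_average (1 / real (Suc n)) f x)) \<longlonglongrightarrow> 0"
      by (simp add: tendsto_norm_zero_iff)
    moreover have "(\<lambda>n. ?I k - c * ?I (gauss_average (1 / real (Suc n)) f)) \<longlonglongrightarrow> ?I k - c * ?I f"
      by (intro tendsto_intros integral_gauss_average_interval_tendsto f)
    ultimately have "?I k - c * ?I f = 0"
      using I_diff[OF ks sm] I_c by (intro LIMSEQ_unique[where X = "\<lambda>n. ?I k - c * ?I (gauss_average (1 / real (Suc n)) f)"]) simp_all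
    then show "?I (\<lambda>x. k x - c * f x) = 0"
      using I_diff[OF ks square_integrable_cmult[OF f(2)]] I_c by simp
  qed
  then show ?thesis
    by (simp add: c_def)
qed

lemma plancherel_cong_AE:
  assumes "plancherel a f g" "AE x in lborel. f x = f' x" "AE x in lborel. g x = g' x"
    and [measurable]: "f' \<in> borel_measurable borel" "g' \<in> borel_measurable borel"
  shows "plancherel a f' g'"
proof -
  have [measurable]: "f \<in> borel_measurable borel" "g \<in> borel_measurable borel"
    using assms(1)[THEN plancherel_square_integrable(1)] assms(1)[THEN plancherel_square_integrable(2)] by auto
  have "square_integrable f'" "square_integrable g'"
    using assms(1) sqnorm_cong_AE[OF assms(2)] sqnorm_cong_AE[OF assms(3)]
    by (auto simp: plancherel_def square_integrable_def)
  moreover have "fourier a (cutoff R f') y = fourier a (cutoff R f) y" for R y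
    unfolding fourier_def
  proof (rule integral_cong_AE)
    show "AE x in lborel. cutoff R f' x * cis (a * x * y) = cutoff R f x * cis (a * x * y)"
      using assms(2) by eventually_elim (simp add: cutoff_def)
  qed measurable
  moreover have "sqnorm (\<lambda>y. fourier a (cutoff R f) y - g' y) = sqnorm (\<lambda>y. fourier a (cutoff R f) y - g y)" for R
    using assms(3) by (intro sqnorm_cong_AE) auto
  ultimately show ?thesis
    using assms(1) by (simp add: plancherel_def)
qed

text \<open>The cutoffs of \<open>f\<close> are integrable and approximate \<open>f\<close>, and their transforms approximate \<open>g\<close>;
  both sides of the inversion formula are continuous in the mean.\<close>

theorem plancherel_inversion:
  assumes fg: "plancherel a f g" and a: "a \<noteq> 0"
  shows "plancherel (- a) g (\<lambda>x. complex_of_real (2 * pi / \<bar>a\<bar>) * f x)"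
proof -
  define c where "c = complex_of_real (2 * pi / \<bar>a\<bar>)"
  note f = plancherel_square_integrable(1)[OF fg] and g = plancherel_square_integrable(2)[OF fg]
  have [measurable]: "f \<in> borel_measurable borel" "g \<in> borel_measurable borel"
    using f g by auto
  obtain k where k: "plancherel (- a) g k"
    using plancherel_exists[OF g] a by (metis neg_equal_0_iff_equal)
  have [measurable]: "k \<in> borel_measurable borel"
    using plancherel_square_integrable(2)[OF k] by auto
  have cutoff: "plancherel (- a) (fourier a (cutoff (real n) f)) (\<lambda>x. c * cutoff (real n) f x)" for n
  proof -
    note fn = integrable_cutoff[OF f, of "real n"] square_integrable_cutoff[OF f, of "real n"]
    obtain h where h: "plancherel (- a) (fourier a (cutoff (real n) f)) h"
      using plancherel_exists[OF square_integrable_fourier[OF fn a]] a by (metis neg_equal_0_iff_equal)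
    have "AE x in lborel. h x = c * cutoff (real n) f x"
      unfolding c_def by (rule plancherel_inversion_integrable[OF fn a h])
    then show ?thesis
      by (intro plancherel_cong_AE[OF h]) auto
  qed
  have "(\<lambda>n. sqnorm (\<lambda>y. g y - fourier a (cutoff (real n) f) y)) \<longlonglongrightarrow> 0"
    using fg filterlim_compose[OF _ filterlim_real_sequentially]
    unfolding plancherel_def by (subst sqnorm_minus_commute) blast
  then have lim1: "(\<lambda>n. sqnorm (\<lambda>x. k x - c * cutoff (real n) f x)) \<longlonglongrightarrow> 0"
    using a by (intro plancherel_continuous[OF k cutoff]) auto
  have "(\<lambda>n. sqnorm (\<lambda>x. f x - cutoff (real n) f x)) \<longlonglongrightarrow> 0"
    by (rule filterlim_compose[OF cutoff_tail_tendsto[OF f] filterlim_real_sequentially])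
  then have "(\<lambda>n. ennreal ((cmod c)\<^sup>2) * sqnorm (\<lambda>x. f x - cutoff (real n) f x)) \<longlonglongrightarrow> 0"
    by (intro tendsto_0_cmult_ennreal) auto
  moreover have "ennreal ((cmod c)\<^sup>2) * sqnorm (\<lambda>x. f x - cutoff (real n) f x) =
      sqnorm (\<lambda>x. c * cutoff (real n) f x - c * f x)" for n
    by (subst sqnorm_cmult[symmetric])
      (auto intro!: sqnorm_cong simp: norm_mult norm_minus_commute simp flip: right_diff_distrib)
  ultimately have lim2: "(\<lambda>n. sqnorm (\<lambda>x. c * cutoff (real n) f x - c * f x)) \<longlonglongrightarrow> 0"
    by simp
  have "sqnorm (\<lambda>x. k x - c * f x) \<le> 2 * sqnorm (\<lambda>x. k x - c * cutoff (real n) f x) +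
      2 * sqnorm (\<lambda>x. c * cutoff (real n) f x - c * f x)" for n
    by (rule sqnorm_triangle) measurable
  from tendsto_0_le_ennreal[OF tendsto_0_double_sum[OF lim1 lim2], OF this]
  have "sqnorm (\<lambda>x. k x - c * f x) = 0"
    by (simp add: tendsto_const_iff)
  then have "AE x in lborel. k x - c * f x = 0"
    by (intro sqnorm_eq_0) measurable
  then have "AE x in lborel. k x = c * f x"
    by simp
  then show ?thesis
    unfolding c_def[symmetric] by (intro plancherel_cong_AE[OF k]) auto
qed

lemma plancherel_unique:
  assumes "plancherel a f g" "plancherel a f' g'" "AE x in lborel. f x = f' x" "a \<noteq> 0"
  shows "AE y in lborel. g y = g' y"
proof -
  have "AE x in lborel. f x - f' x = 0"
    using assms(3) by eventually_elim simp
  then have "sqnorm (\<lambda>x. f x - f' x) = 0"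
    using sqnorm_cong_AE[of "\<lambda>x. f x - f' x" "\<lambda>_. 0"] by (simp add: sqnorm_def)
  then have "sqnorm (\<lambda>y. g y - g' y) = 0"
    using plancherel_bound[OF plancherel_diff[OF assms(1,2)] assms(4)] by simp
  moreover have "(\<lambda>y. g y - g' y) \<in> borel_measurable borel"
    using plancherel_square_integrable(2)[OF plancherel_diff[OF assms(1,2)]] by auto
  ultimately have "AE y in lborel. g y - g' y = 0"
    by (intro sqnorm_eq_0)
  then show ?thesis
    by simp
qed

section \<open>The scalar fractional Fourier transform\<close>

text \<open>Multiplication by the square root of the weight identifies the weighted space with the
  ordinary space of square-integrable functions.\<close>

definition weighted :: "real \<Rightarrow> (real \<Rightarrow> complex) \<Rightarrow> real \<Rightarrow> complex" where
  "weighted \<sigma> f x = complex_of_real (exp (- \<sigma> * x\<^sup>2 / 2)) * f x"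

text \<open>The unimodular factor contributed by the imaginary part of \<open>1 / (1 - t\<^sup>2)\<close>.\<close>

definition chirp :: "real \<Rightarrow> complex \<Rightarrow> real \<Rightarrow> complex" where
  "chirp \<sigma> t x = cis (- \<sigma> * Im (1 / (1 - t\<^sup>2)) * x\<^sup>2)"

definition frequency :: "real \<Rightarrow> complex \<Rightarrow> real" where
  "frequency \<sigma> t = 2 * \<sigma> * Im (t / (1 - t\<^sup>2))"

definition scalar_factor :: "real \<Rightarrow> complex \<Rightarrow> complex" where
  "scalar_factor \<sigma> t = complex_of_real (sqrt (\<sigma> / pi)) / csqrt (1 - t\<^sup>2)"

definition scalar_kernel :: "real \<Rightarrow> complex \<Rightarrow> real \<Rightarrow> real \<Rightarrow> complex" where
  "scalar_kernel \<sigma> t y x = exp (- (complex_of_real \<sigma> / (1 - t\<^sup>2)) *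
     (complex_of_real x - t * complex_of_real y)\<^sup>2)"

definition scalar_trunc :: "real \<Rightarrow> complex \<Rightarrow> (real \<Rightarrow> complex) \<Rightarrow> real \<Rightarrow> real \<Rightarrow> complex" where
  "scalar_trunc \<sigma> t f R y = scalar_factor \<sigma> t * (LINT x:{-R..R}|lborel. f x * scalar_kernel \<sigma> t y x)"

text \<open>The analogue for one coordinate of a limit in the norm of the weighted space.\<close>

definition scalar_frft :: "real \<Rightarrow> complex \<Rightarrow> (real \<Rightarrow> complex) \<Rightarrow> (real \<Rightarrow> complex) \<Rightarrow> bool" where
  "scalar_frft \<sigma> t f g \<longleftrightarrow> square_integrable (weighted \<sigma> f) \<and> square_integrable (weighted \<sigma> g) \<and>
     ((\<lambda>R. sqnorm (weighted \<sigma> (\<lambda>y. scalar_trunc \<sigma> t f R y - g y))) \<longlongrightarrow> 0) at_top"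

lemma measurable_weighted_iff:
  "weighted \<sigma> f \<in> borel_measurable borel \<longleftrightarrow> f \<in> borel_measurable borel"
proof
  assume [measurable]: "weighted \<sigma> f \<in> borel_measurable borel"
  have "f = (\<lambda>x. complex_of_real (exp (\<sigma> * x\<^sup>2 / 2)) * weighted \<sigma> f x)"
    by (auto simp: weighted_def exp_minus field_simps simp flip: of_real_mult exp_add)
  also have "\<dots> \<in> borel_measurable borel"
    by measurable
  finally show "f \<in> borel_measurable borel" .
next
  assume [measurable]: "f \<in> borel_measurable borel"
  show "weighted \<sigma> f \<in> borel_measurable borel"
    unfolding weighted_def[abs_def] by measurable
qed

lemma norm_weighted: "(cmod (weighted \<sigma> f x))\<^sup>2 = (cmod (f x))\<^sup>2 * exp (- \<sigma> * x\<^sup>2)"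
proof -
  have "(exp (- \<sigma> * x\<^sup>2 / 2))\<^sup>2 = exp (- \<sigma> * x\<^sup>2)"
    by (simp flip: exp_double)
  then show ?thesis
    unfolding weighted_def norm_mult power_mult_distrib by simp
qed

lemma sq_integrable_iff: "sq_integrable \<sigma> f \<longleftrightarrow> square_integrable (weighted \<sigma> f)"
proof -
  have "square_integrable (weighted \<sigma> f) \<longleftrightarrow>
      weighted \<sigma> f \<in> borel_measurable borel \<and> integrable lborel (\<lambda>x. (cmod (weighted \<sigma> f x))\<^sup>2)"
    using square_integrable_integrable_sq integrable_sq_square_integrable square_integrable_measurable by blast
  then show ?thesis
    by (simp add: sq_integrable_def norm_weighted measurable_weighted_iff)
qed

lemma weighted_diff: "weighted \<sigma> (\<lambda>x. f x - g x) x = weighted \<sigma> f x - weighted \<sigma> g x"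
  by (simp add: weighted_def right_diff_distrib)

lemma norm_chirp: "cmod (chirp \<sigma> t x) = 1"
  by (simp add: chirp_def)

lemma chirp_nz: "chirp \<sigma> t x \<noteq> 0"
  by (simp add: chirp_def)

lemma measurable_chirp [measurable]: "chirp \<sigma> t \<in> borel_measurable borel"
  unfolding chirp_def[abs_def] by measurable

lemma unit_nz:
  assumes "cmod t = 1" "t\<^sup>2 \<noteq> 1"
  shows "t \<noteq> 0" "1 - t\<^sup>2 \<noteq> 0"
  using assms by auto

lemma cnj_unit:
  assumes "cmod t = 1"
  shows "cnj t = 1 / t"
proof -
  have "t * cnj t = 1"
    using complex_norm_square[of t] assms by simp
  moreover from this have "t \<noteq> 0"
    by auto
  ultimately show ?thesis
    by (simp add: field_simps)
qed

text \<open>On the unit circle conjugation is inversion, which sends \<open>z = 1 / (1 - t\<^sup>2)\<close> to \<open>1 - z\<close>.\<close>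

lemma Re_inverse_one_minus_sq:
  assumes "cmod t = 1" "t\<^sup>2 \<noteq> 1"
  shows "Re (1 / (1 - t\<^sup>2)) = 1 / 2"
proof -
  define z where "z = 1 / (1 - t\<^sup>2)"
  have "cnj z = 1 / (1 - (1 / t)\<^sup>2)"
    by (simp add: z_def cnj_unit[OF assms(1)])
  also have "\<dots> = 1 - z"
    using unit_nz[OF assms] assms(2) by (simp add: z_def divide_simps) (auto simp: algebra_simps)
  finally have "Re (cnj z) = Re (1 - z)"
    by (rule arg_cong)
  then show ?thesis
    unfolding z_def[symmetric] by simp
qed

text \<open>Here conjugation, that is inversion of \<open>t\<close>, changes the sign of \<open>t / (1 - t\<^sup>2)\<close>.\<close>

lemma Re_ratio_one_minus_sq:
  assumes "cmod t = 1" "t\<^sup>2 \<noteq> 1"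
  shows "Re (t / (1 - t\<^sup>2)) = 0"
proof -
  define z where "z = t / (1 - t\<^sup>2)"
  have "cnj z = (1 / t) / (1 - (1 / t)\<^sup>2)"
    by (simp add: z_def cnj_unit[OF assms(1)])
  also have "\<dots> = - z"
    using unit_nz[OF assms] assms(2)
    by (simp add: z_def divide_simps) (auto simp: algebra_simps power2_eq_square)
  finally have "Re (cnj z) = Re (- z)"
    by (rule arg_cong)
  then show ?thesis
    unfolding z_def[symmetric] by simp
qed

lemma abs_frequency:
  assumes "cmod t = 1" "t\<^sup>2 \<noteq> 1" "\<sigma> > 0"
  shows "\<bar>frequency \<sigma> t\<bar> = 2 * \<sigma> / cmod (1 - t\<^sup>2)"
proof -
  have "\<bar>Im (t / (1 - t\<^sup>2))\<bar> = 1 / cmod (1 - t\<^sup>2)"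
    using cmod_eq_Im[OF Re_ratio_one_minus_sq[OF assms(1,2)]] assms(1) by (simp add: norm_divide)
  then show ?thesis
    using assms(3) by (simp only: frequency_def abs_mult) simp
qed

lemma frequency_nz:
  assumes "cmod t = 1" "t\<^sup>2 \<noteq> 1" "\<sigma> > 0"
  shows "frequency \<sigma> t \<noteq> 0"
  using abs_frequency[OF assms] unit_nz[OF assms(1,2)] assms(3) by auto

lemma frequency_cnj: "frequency \<sigma> (cnj t) = - frequency \<sigma> t"
proof -
  define z where "z = t / (1 - t\<^sup>2)"
  have "cnj t / (1 - (cnj t)\<^sup>2) = cnj z"
    by (simp add: z_def)
  then show ?thesis
    unfolding frequency_def z_def[symmetric] by simp
qed

lemma chirp_cnj: "chirp \<sigma> (cnj t) x = cnj (chirp \<sigma> t x)"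
proof -
  define z where "z = 1 / (1 - t\<^sup>2)"
  have "1 / (1 - (cnj t)\<^sup>2) = cnj z"
    by (simp add: z_def)
  then show ?thesis
    unfolding chirp_def z_def[symmetric] by (simp add: cis_cnj)
qed

lemma measurable_cnj_chirp [measurable]: "(\<lambda>x. cnj (chirp \<sigma> t x)) \<in> borel_measurable borel"
  by (simp flip: chirp_cnj)

text \<open>The principal root commutes with conjugation off the negative axis, and \<open>1 - t\<^sup>2\<close> lies off it
  because its inverse has real part \<open>1 / 2\<close>.\<close>

lemma scalar_factor_cnj:
  assumes "cmod t = 1" "t\<^sup>2 \<noteq> 1"
  shows "scalar_factor \<sigma> (cnj t) = cnj (scalar_factor \<sigma> t)"
proof -
  have "1 - t\<^sup>2 \<notin> \<real>\<^sub>\<le>\<^sub>0"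
  proof
    assume "1 - t\<^sup>2 \<in> \<real>\<^sub>\<le>\<^sub>0"
    then obtain r where r: "r \<le> 0" "1 - t\<^sup>2 = complex_of_real r"
      by (auto simp: nonpos_Reals_def)
    then have "Re (1 / (1 - t\<^sup>2)) \<le> 0"
      by (simp add: Re_divide_of_real)
    then show False
      using Re_inverse_one_minus_sq[OF assms] by simp
  qed
  from cnj_csqrt[OF this] show ?thesis
    by (simp add: scalar_factor_def)
qed

lemma scalar_factor_nz:
  assumes "cmod t = 1" "t\<^sup>2 \<noteq> 1" "\<sigma> > 0"
  shows "scalar_factor \<sigma> t \<noteq> 0"
  using unit_nz[OF assms(1,2)] assms(3) by (simp add: scalar_factor_def)

text \<open>The normalisation of the transform is exactly the one that cancels the constant of Fourier
  inversion.\<close>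

lemma norm_scalar_factor:
  assumes "cmod t = 1" "t\<^sup>2 \<noteq> 1" "\<sigma> > 0"
  shows "2 * pi / \<bar>frequency \<sigma> t\<bar> * (cmod (scalar_factor \<sigma> t))\<^sup>2 = 1"
proof -
  have "(cmod (scalar_factor \<sigma> t))\<^sup>2 = \<sigma> / pi / cmod (1 - t\<^sup>2)"
    using assms by (simp add: scalar_factor_def norm_divide power_divide)
  then show ?thesis
    using assms unit_nz[OF assms(1,2)] by (simp add: abs_frequency)
qed

text \<open>Expand the square in the exponent. The real part \<open>1 / 2\<close> of \<open>1 / (1 - t\<^sup>2)\<close> produces the two
  weights, its imaginary part the two chirps, and the imaginary number \<open>t / (1 - t\<^sup>2)\<close> in the
  mixed term an oscillation.\<close>

lemma scalar_kernel_eq: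
  assumes "cmod t = 1" "t\<^sup>2 \<noteq> 1"
  shows "complex_of_real (exp (- \<sigma> * y\<^sup>2 / 2)) * scalar_kernel \<sigma> t y x =
    chirp \<sigma> t y * (complex_of_real (exp (- \<sigma> * x\<^sup>2 / 2)) * chirp \<sigma> t x * cis (frequency \<sigma> t * x * y))"
proof -
  define b where "b = Im (1 / (1 - t\<^sup>2))"
  define m where "m = Im (t / (1 - t\<^sup>2))"
  have k: "1 / (1 - t\<^sup>2) = 1 / 2 + \<i> * complex_of_real b"
    using Re_inverse_one_minus_sq[OF assms] by (simp add: complex_eq_iff b_def)
  have tk: "t * (1 / (1 - t\<^sup>2)) = \<i> * complex_of_real m"
    using Re_ratio_one_minus_sq[OF assms] by (simp add: complex_eq_iff m_def)
  have ttk: "t\<^sup>2 * (1 / (1 - t\<^sup>2)) = 1 / (1 - t\<^sup>2) - 1"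
    using unit_nz[OF assms] by (simp add: field_simps)
  let ?s = "complex_of_real \<sigma>" and ?x = "complex_of_real x" and ?y = "complex_of_real y"
  have "- (?s / (1 - t\<^sup>2)) * (?x - t * ?y)\<^sup>2 =
      - ?s * (1 / (1 - t\<^sup>2)) * ?x\<^sup>2 + 2 * ?s * (t * (1 / (1 - t\<^sup>2))) * ?x * ?y
      - ?s * (t\<^sup>2 * (1 / (1 - t\<^sup>2))) * ?y\<^sup>2"
    by (simp add: power2_eq_square diff_divide_distrib add_divide_distrib algebra_simps)
  also have "\<dots> = (?s * ?y\<^sup>2 / 2 + - (?s * ?x\<^sup>2 / 2)) + \<i> * complex_of_real (- \<sigma> * b * y\<^sup>2 + (- \<sigma> * b * x\<^sup>2 + 2 * \<sigma> * m * x * y))"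
    unfolding ttk unfolding tk unfolding k by (simp add: algebra_simps)
  finally have "scalar_kernel \<sigma> t y x = exp (?s * ?y\<^sup>2 / 2) * exp (- (?s * ?x\<^sup>2 / 2)) *
      (chirp \<sigma> t y * (chirp \<sigma> t x * cis (frequency \<sigma> t * x * y)))"
    unfolding scalar_kernel_def chirp_def frequency_def b_def[symmetric] m_def[symmetric] cis_mult
    by (simp only: exp_add cis_conv_exp)
  moreover have "complex_of_real (exp (- \<sigma> * y\<^sup>2 / 2)) * exp (?s * ?y\<^sup>2 / 2) = 1"
    by (simp add: exp_minus flip: exp_of_real)
  moreover have "exp (- (?s * ?x\<^sup>2 / 2)) = complex_of_real (exp (- \<sigma> * x\<^sup>2 / 2))"
    by (simp flip: exp_of_real)
  ultimately show ?thesis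
    by (simp add: mult.assoc[symmetric] del: of_real_exp)
qed

lemma weighted_scalar_trunc:
  assumes "cmod t = 1" "t\<^sup>2 \<noteq> 1"
  shows "weighted \<sigma> (scalar_trunc \<sigma> t f R) y =
    scalar_factor \<sigma> t * chirp \<sigma> t y * fourier (frequency \<sigma> t) (cutoff R (\<lambda>x. chirp \<sigma> t x * weighted \<sigma> f x)) y"
proof -
  let ?e = "complex_of_real (exp (- \<sigma> * y\<^sup>2 / 2))"
  have "?e * (LINT x:{-R..R}|lborel. f x * scalar_kernel \<sigma> t y x) =
      (\<integral>x. ?e * (indicator {-R..R} x *\<^sub>R (f x * scalar_kernel \<sigma> t y x)) \<partial>lborel)"
    unfolding set_lebesgue_integral_def by (rule integral_mult_right_zero[symmetric])
  also have "\<dots> = (\<integral>x. chirp \<sigma> t y * (cutoff R (\<lambda>x. chirp \<sigma> t x * weighted \<sigma> f x) x *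
      cis (frequency \<sigma> t * x * y)) \<partial>lborel)"
  proof (intro Bochner_Integration.integral_cong refl)
    fix x
    have "?e * (indicator {-R..R} x *\<^sub>R (f x * scalar_kernel \<sigma> t y x)) =
        indicator {-R..R} x * f x * (?e * scalar_kernel \<sigma> t y x)"
      by (simp add: indicator_def)
    also have "\<dots> = chirp \<sigma> t y * (cutoff R (\<lambda>x. chirp \<sigma> t x * weighted \<sigma> f x) x * cis (frequency \<sigma> t * x * y))"
      unfolding scalar_kernel_eq[OF assms] by (simp only: cutoff_def weighted_def ac_simps)
    finally show "?e * (indicator {-R..R} x *\<^sub>R (f x * scalar_kernel \<sigma> t y x)) = \<dots>" .
  qed
  also have "\<dots> = chirp \<sigma> t y * fourier (frequency \<sigma> t) (cutoff R (\<lambda>x. chirp \<sigma> t x * weighted \<sigma> f x)) y"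
    unfolding fourier_def by (rule integral_mult_right_zero)
  finally show ?thesis
    unfolding weighted_def[of \<sigma> "scalar_trunc \<sigma> t f R"] scalar_trunc_def by (simp only: ac_simps)
qed

lemma square_integrable_unimodular:
  assumes "\<And>x. cmod (p x) = 1" "p \<in> borel_measurable borel" "square_integrable f"
  shows "square_integrable (\<lambda>x. p x * f x)"
proof (rule square_integrable_dominated[OF assms(3)])
  show "(\<lambda>x. p x * f x) \<in> borel_measurable borel"
    using assms by (intro borel_measurable_times) auto
qed (simp add: norm_mult assms(1))

lemma integrable_scalar_trunc:
  assumes "cmod t = 1" "t\<^sup>2 \<noteq> 1" "square_integrable (weighted \<sigma> f)"
  shows "integrable lborel (\<lambda>x. indicator {-R..R} x *\<^sub>R (f x * scalar_kernel \<sigma> t y x))"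
proof -
  have "square_integrable (\<lambda>x. chirp \<sigma> t x * weighted \<sigma> f x)"
    by (intro square_integrable_unimodular norm_chirp measurable_chirp assms)
  then have "integrable lborel (\<lambda>x. cutoff R (\<lambda>x. chirp \<sigma> t x * weighted \<sigma> f x) x *
      cis (frequency \<sigma> t * x * y))"
    by (intro integrable_mult_cis integrable_cutoff)
  then have "integrable lborel (\<lambda>x. complex_of_real (exp (\<sigma> * y\<^sup>2 / 2)) * chirp \<sigma> t y *
      (cutoff R (\<lambda>x. chirp \<sigma> t x * weighted \<sigma> f x) x * cis (frequency \<sigma> t * x * y)))"
    by (rule integrable_mult_right)
  moreover have "complex_of_real (exp (\<sigma> * y\<^sup>2 / 2)) * chirp \<sigma> t y *
      (cutoff R (\<lambda>x. chirp \<sigma> t x * weighted \<sigma> f x) x * cis (frequency \<sigma> t * x * y)) =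
      indicator {-R..R} x *\<^sub>R (f x * scalar_kernel \<sigma> t y x)" for x
  proof -
    have one: "complex_of_real (exp (\<sigma> * y\<^sup>2 / 2)) * complex_of_real (exp (- \<sigma> * y\<^sup>2 / 2)) = 1"
      by (simp add: exp_minus flip: of_real_mult)
    have "complex_of_real (exp (\<sigma> * y\<^sup>2 / 2)) * chirp \<sigma> t y *
      (cutoff R (\<lambda>x. chirp \<sigma> t x * weighted \<sigma> f x) x * cis (frequency \<sigma> t * x * y)) =
      complex_of_real (exp (\<sigma> * y\<^sup>2 / 2)) * (indicator {-R..R} x * f x * (chirp \<sigma> t y *
      (complex_of_real (exp (- \<sigma> * x\<^sup>2 / 2)) * chirp \<sigma> t x * cis (frequency \<sigma> t * x * y))))"
      by (simp only: cutoff_def weighted_def ac_simps)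
    also have "\<dots> = (complex_of_real (exp (\<sigma> * y\<^sup>2 / 2)) * complex_of_real (exp (- \<sigma> * y\<^sup>2 / 2))) *
        (indicator {-R..R} x * f x * scalar_kernel \<sigma> t y x)"
      unfolding scalar_kernel_eq[OF assms(1,2), symmetric] by (simp only: ac_simps)
    finally show ?thesis
      unfolding one by (simp add: indicator_def)
  qed
  ultimately show ?thesis
    by simp
qed

lemma square_integrable_weighted_scalar_trunc:
  assumes "cmod t = 1" "t\<^sup>2 \<noteq> 1" "\<sigma> > 0" "square_integrable (weighted \<sigma> f)"
  shows "square_integrable (weighted \<sigma> (scalar_trunc \<sigma> t f R))"
proof -
  have "square_integrable (\<lambda>x. chirp \<sigma> t x * weighted \<sigma> f x)"
    by (intro square_integrable_unimodular norm_chirp measurable_chirp assms)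
  then have "square_integrable (fourier (frequency \<sigma> t) (cutoff R (\<lambda>x. chirp \<sigma> t x * weighted \<sigma> f x)))"
    by (intro square_integrable_fourier integrable_cutoff square_integrable_cutoff frequency_nz assms)
  then have "square_integrable (\<lambda>y. scalar_factor \<sigma> t * (chirp \<sigma> t y *
      fourier (frequency \<sigma> t) (cutoff R (\<lambda>x. chirp \<sigma> t x * weighted \<sigma> f x)) y))"
    by (intro square_integrable_cmult square_integrable_unimodular norm_chirp measurable_chirp)
  then show ?thesis
    by (simp add: weighted_scalar_trunc[OF assms(1,2), abs_def] mult.assoc)
qed

text \<open>The factorisation of the kernel, read as a statement about limits in the mean.\<close>

lemma scalar_frft_iff_plancherel:
  assumes t: "cmod t = 1" "t\<^sup>2 \<noteq> 1" and \<sigma>: "\<sigma> > 0"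
  shows "scalar_frft \<sigma> t f g \<longleftrightarrow> plancherel (frequency \<sigma> t) (\<lambda>x. chirp \<sigma> t x * weighted \<sigma> f x)
    (\<lambda>y. 1 / scalar_factor \<sigma> t * (cnj (chirp \<sigma> t y) * weighted \<sigma> g y))"
    (is "_ \<longleftrightarrow> plancherel ?a ?F ?G")
proof -
  note C = scalar_factor_nz[OF t \<sigma>]
  have chirp_inv: "cnj (chirp \<sigma> t x) * chirp \<sigma> t x = 1" for x
    by (simp add: chirp_def cis_cnj cis_mult)
  have f: "square_integrable ?F \<longleftrightarrow> square_integrable (weighted \<sigma> f)"
  proof
    assume "square_integrable ?F"
    then have "square_integrable (\<lambda>x. cnj (chirp \<sigma> t x) * ?F x)"
      by (rule square_integrable_unimodular[rotated 2]) (simp_all add: norm_chirp measurable_cnj_chirp)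
    then show "square_integrable (weighted \<sigma> f)"
      by (simp add: mult.assoc[symmetric] chirp_inv)
  qed (intro square_integrable_unimodular norm_chirp measurable_chirp)
  have g: "square_integrable ?G \<longleftrightarrow> square_integrable (weighted \<sigma> g)"
  proof
    assume "square_integrable ?G"
    then have "square_integrable (\<lambda>x. scalar_factor \<sigma> t * (chirp \<sigma> t x * ?G x))"
      by (rule square_integrable_cmult[OF square_integrable_unimodular[OF norm_chirp measurable_chirp]])
    moreover have "scalar_factor \<sigma> t * (chirp \<sigma> t x * ?G x) = weighted \<sigma> g x" for x
      using C chirp_inv[of x] by (simp add: field_simps)
    ultimately show "square_integrable (weighted \<sigma> g)"
      by simp
  next
    assume "square_integrable (weighted \<sigma> g)"
    then show "square_integrable ?G"
      by (intro square_integrable_cmult square_integrable_unimodular measurable_cnj_chirp) (simp_all add: norm_chirp)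
  qed
  have eq: "sqnorm (weighted \<sigma> (\<lambda>y. scalar_trunc \<sigma> t f R y - g y)) =
      ennreal ((cmod (scalar_factor \<sigma> t))\<^sup>2) * sqnorm (\<lambda>y. fourier ?a (cutoff R ?F) y - ?G y)"
    if "square_integrable ?F" "square_integrable ?G" for R
  proof -
    have "weighted \<sigma> (\<lambda>y. scalar_trunc \<sigma> t f R y - g y) y =
        chirp \<sigma> t y * (scalar_factor \<sigma> t * (fourier ?a (cutoff R ?F) y - ?G y))" for y
      using C chirp_inv[of y] unfolding weighted_diff weighted_scalar_trunc[OF t]
      by (simp add: field_simps)
    then have "sqnorm (weighted \<sigma> (\<lambda>y. scalar_trunc \<sigma> t f R y - g y)) =
        sqnorm (\<lambda>y. scalar_factor \<sigma> t * (fourier ?a (cutoff R ?F) y - ?G y))"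
      by (intro sqnorm_cong) (simp add: norm_mult norm_chirp)
    also have "\<dots> = ennreal ((cmod (scalar_factor \<sigma> t))\<^sup>2) * sqnorm (\<lambda>y. fourier ?a (cutoff R ?F) y - ?G y)"
      using that by (intro sqnorm_cmult borel_measurable_diff measurable_fourier measurable_cutoff) auto
    finally show ?thesis .
  qed
  have lim: "((\<lambda>R. ennreal ((cmod (scalar_factor \<sigma> t))\<^sup>2) * u R) \<longlongrightarrow> 0) at_top \<longleftrightarrow> (u \<longlongrightarrow> 0) at_top"
    for u :: "real \<Rightarrow> ennreal"
  proof
    assume "((\<lambda>R. ennreal ((cmod (scalar_factor \<sigma> t))\<^sup>2) * u R) \<longlongrightarrow> 0) at_top"
    then have "((\<lambda>R. ennreal (1 / (cmod (scalar_factor \<sigma> t))\<^sup>2) * (ennreal ((cmod (scalar_factor \<sigma> t))\<^sup>2) * u R)) \<longlongrightarrow> 0) at_top"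
      by (rule tendsto_0_cmult_ennreal) simp
    moreover have "ennreal (1 / (cmod (scalar_factor \<sigma> t))\<^sup>2) * ennreal ((cmod (scalar_factor \<sigma> t))\<^sup>2) = 1"
      using C by (simp flip: ennreal_mult)
    ultimately show "(u \<longlongrightarrow> 0) at_top"
      by (simp only: mult.assoc[symmetric] mult_1)
  next
    assume "(u \<longlongrightarrow> 0) at_top"
    then show "((\<lambda>R. ennreal ((cmod (scalar_factor \<sigma> t))\<^sup>2) * u R) \<longlongrightarrow> 0) at_top"
      by (intro tendsto_0_cmult_ennreal) auto
  qed
  show ?thesis
    unfolding scalar_frft_def plancherel_def f[symmetric] g[symmetric]
    using eq lim by (auto simp only: cong: conj_cong)
qed

lemma scalar_frft_exists:
  assumes t: "cmod t = 1" "t\<^sup>2 \<noteq> 1" and \<sigma>: "\<sigma> > 0" and f: "square_integrable (weighted \<sigma> f)"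
  obtains g where "scalar_frft \<sigma> t f g"
proof -
  have "square_integrable (\<lambda>x. chirp \<sigma> t x * weighted \<sigma> f x)"
    by (intro square_integrable_unimodular norm_chirp measurable_chirp f)
  then obtain h where h: "plancherel (frequency \<sigma> t) (\<lambda>x. chirp \<sigma> t x * weighted \<sigma> f x) h"
    by (rule plancherel_exists[OF _ frequency_nz[OF t \<sigma>]])
  define g where "g y = complex_of_real (exp (\<sigma> * y\<^sup>2 / 2)) * (scalar_factor \<sigma> t * chirp \<sigma> t y * h y)" for y
  have "1 / scalar_factor \<sigma> t * (cnj (chirp \<sigma> t y) * weighted \<sigma> g y) = h y" for y
  proof -
    have "complex_of_real (exp (- \<sigma> * y\<^sup>2 / 2)) * complex_of_real (exp (\<sigma> * y\<^sup>2 / 2)) = 1"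
      by (simp add: exp_minus flip: of_real_mult)
    then have "weighted \<sigma> g y = scalar_factor \<sigma> t * (chirp \<sigma> t y * h y)"
      unfolding weighted_def g_def by (simp only: mult.assoc[symmetric] mult_1)
    moreover have "cnj (chirp \<sigma> t y) * (chirp \<sigma> t y * h y) = h y"
      by (simp add: chirp_def cis_cnj cis_mult mult.assoc[symmetric])
    ultimately show ?thesis
      using scalar_factor_nz[OF t \<sigma>] by (simp add: mult.left_commute)
  qed
  then have "scalar_frft \<sigma> t f g"
    using h by (simp add: scalar_frft_iff_plancherel[OF t \<sigma>])
  with that show thesis .
qed

text \<open>Conjugating \<open>t\<close> negates the frequency and conjugates the chirp and the constant, so Fourier
  inversion gives the claim once the constants are matched.\<close>

theorem scalar_frft_inversion:
  assumes t: "cmod t = 1" "t\<^sup>2 \<noteq> 1" and \<sigma>: "\<sigma> > 0" and fg: "scalar_frft \<sigma> t f g"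
  shows "scalar_frft \<sigma> (cnj t) g f"
proof -
  let ?a = "frequency \<sigma> t" and ?C = "scalar_factor \<sigma> t"
  note C = scalar_factor_nz[OF t \<sigma>]
  have t': "cmod (cnj t) = 1" "(cnj t)\<^sup>2 \<noteq> 1"
    using t by (simp_all flip: complex_cnj_power)
  have "plancherel ?a (\<lambda>x. chirp \<sigma> t x * weighted \<sigma> f x)
      (\<lambda>y. 1 / ?C * (cnj (chirp \<sigma> t y) * weighted \<sigma> g y))"
    using fg by (simp add: scalar_frft_iff_plancherel[OF t \<sigma>])
  from plancherel_cmult[OF plancherel_inversion[OF this frequency_nz[OF t \<sigma>]], of ?C]
  have "plancherel (- ?a) (\<lambda>y. cnj (chirp \<sigma> t y) * weighted \<sigma> g y)
      (\<lambda>x. ?C * (complex_of_real (2 * pi / \<bar>?a\<bar>) * (chirp \<sigma> t x * weighted \<sigma> f x)))"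
    using C by simp
  moreover have "?C * complex_of_real (2 * pi / \<bar>?a\<bar>) = 1 / cnj ?C"
  proof -
    have "complex_of_real (2 * pi / \<bar>?a\<bar>) * (?C * cnj ?C) = 1"
      using norm_scalar_factor[OF t \<sigma>] unfolding complex_norm_square[symmetric]
      by (metis of_real_1 of_real_mult)
    then show ?thesis
      using C by (simp add: field_simps)
  qed
  ultimately have "plancherel (- ?a) (\<lambda>y. cnj (chirp \<sigma> t y) * weighted \<sigma> g y)
      (\<lambda>x. 1 / cnj ?C * (chirp \<sigma> t x * weighted \<sigma> f x))"
    by (simp only: mult.assoc[symmetric])
  then show ?thesis
    unfolding scalar_frft_iff_plancherel[OF t' \<sigma>] frequency_cnj chirp_cnj scalar_factor_cnj[OF t]
    by simp
qed

lemma AE_weighted: "(AE x in lborel. weighted \<sigma> f x = weighted \<sigma> g x) \<longleftrightarrow> (AE x in lborel. f x = g x)"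
  by (simp add: weighted_def)

lemma scalar_frft_unique:
  assumes t: "cmod t = 1" "t\<^sup>2 \<noteq> 1" and \<sigma>: "\<sigma> > 0"
    and "scalar_frft \<sigma> t f g" "scalar_frft \<sigma> t f' g'" "AE x in lborel. f x = f' x"
  shows "AE y in lborel. g y = g' y"
proof -
  have "AE x in lborel. chirp \<sigma> t x * weighted \<sigma> f x = chirp \<sigma> t x * weighted \<sigma> f' x"
    using assms(6) by eventually_elim (simp add: weighted_def)
  from plancherel_unique[OF assms(4,5)[unfolded scalar_frft_iff_plancherel[OF t \<sigma>]] this frequency_nz[OF t \<sigma>]]
  have "AE y in lborel. weighted \<sigma> g y = weighted \<sigma> g' y"
    using scalar_factor_nz[OF t \<sigma>] chirp_nz by simp
  then show ?thesis
    by (simp add: AE_weighted)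
qed

lemma scalar_frft_cong_AE:
  assumes t: "cmod t = 1" "t\<^sup>2 \<noteq> 1" and \<sigma>: "\<sigma> > 0"
    and "scalar_frft \<sigma> t f g" "AE x in lborel. f x = f' x" "AE x in lborel. g x = g' x"
    and "square_integrable (weighted \<sigma> f')" "square_integrable (weighted \<sigma> g')"
  shows "scalar_frft \<sigma> t f' g'"
  unfolding scalar_frft_iff_plancherel[OF t \<sigma>]
proof (rule plancherel_cong_AE[OF assms(4)[unfolded scalar_frft_iff_plancherel[OF t \<sigma>]]])
  have [measurable]: "weighted \<sigma> f' \<in> borel_measurable borel" "weighted \<sigma> g' \<in> borel_measurable borel"
    using assms by auto
  show "AE x in lborel. chirp \<sigma> t x * weighted \<sigma> f x = chirp \<sigma> t x * weighted \<sigma> f' x"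
    using assms(5) by eventually_elim (simp add: weighted_def)
  show "AE y in lborel. 1 / scalar_factor \<sigma> t * (cnj (chirp \<sigma> t y) * weighted \<sigma> g y) =
      1 / scalar_factor \<sigma> t * (cnj (chirp \<sigma> t y) * weighted \<sigma> g' y)"
    using assms(6) by eventually_elim (simp add: weighted_def)
  show "(\<lambda>x. chirp \<sigma> t x * weighted \<sigma> f' x) \<in> borel_measurable borel"
    "(\<lambda>y. 1 / scalar_factor \<sigma> t * (cnj (chirp \<sigma> t y) * weighted \<sigma> g' y)) \<in> borel_measurable borel"
    by measurable
qed

text \<open>By Fatou's lemma the lower limit of the squared moduli vanishes almost everywhere, so a
  pointwise limit, wherever it exists, is zero.\<close>

lemma sqnorm_limit_pointwise:
  assumes [measurable]: "\<And>n. u n \<in> borel_measurable borel"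
    and lim: "(\<lambda>n. sqnorm (u n)) \<longlonglongrightarrow> 0"
  shows "AE x in lborel. \<forall>l. (\<lambda>n. u n x) \<longlonglongrightarrow> l \<longrightarrow> l = 0"
proof -
  have "(\<integral>\<^sup>+x. liminf (\<lambda>n. ennreal ((cmod (u n x))\<^sup>2)) \<partial>lborel) \<le> liminf (\<lambda>n. sqnorm (u n))"
    unfolding sqnorm_def by (intro nn_integral_liminf) measurable
  also have "\<dots> = 0"
    by (rule lim_imp_Liminf[OF sequentially_bot lim])
  finally have "AE x in lborel. liminf (\<lambda>n. ennreal ((cmod (u n x))\<^sup>2)) = 0"
    by (subst (asm) le_zero_eq, subst (asm) nn_integral_0_iff_AE) auto
  then show ?thesis
  proof eventually_elim
    case (elim x)
    show ?case
    proof (intro allI impI)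
      fix l
      assume "(\<lambda>n. u n x) \<longlonglongrightarrow> l"
      then have "(\<lambda>n. ennreal ((cmod (u n x))\<^sup>2)) \<longlonglongrightarrow> ennreal ((cmod l)\<^sup>2)"
        by (intro tendsto_intros)
      from lim_imp_Liminf[OF sequentially_bot this] elim show "l = 0"
        by simp
    qed
  qed
qed

text \<open>Where the full integral exists, dominated convergence makes the truncated integrals converge
  pointwise, and a pointwise limit agrees with the limit in the mean.\<close>

lemma scalar_frft_pointwise:
  assumes t: "cmod t = 1" "t\<^sup>2 \<noteq> 1" and \<sigma>: "\<sigma> > 0" and fg: "scalar_frft \<sigma> t f g"
  shows "AE y in lborel. integrable lborel (\<lambda>x. f x * scalar_kernel \<sigma> t y x) \<longrightarrow>
    g y = scalar_factor \<sigma> t * (\<integral>x. f x * scalar_kernel \<sigma> t y x \<partial>lborel)"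
proof -
  define u where "u n = weighted \<sigma> (\<lambda>y. scalar_trunc \<sigma> t f (real n) y - g y)" for n
  have [measurable]: "weighted \<sigma> g \<in> borel_measurable borel"
      "weighted \<sigma> (scalar_trunc \<sigma> t f R) \<in> borel_measurable borel" for R
    using fg square_integrable_weighted_scalar_trunc[OF t \<sigma>, of f R] by (auto simp: scalar_frft_def)
  have [measurable]: "u n \<in> borel_measurable borel" for n
    unfolding u_def weighted_diff[abs_def] by measurable
  have "(\<lambda>n. sqnorm (u n)) \<longlonglongrightarrow> 0"
    using fg filterlim_compose[OF _ filterlim_real_sequentially]
    unfolding u_def scalar_frft_def by blast
  then have "AE y in lborel. \<forall>l. (\<lambda>n. u n y) \<longlonglongrightarrow> l \<longrightarrow> l = 0"
    by (intro sqnorm_limit_pointwise) auto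
  then show ?thesis
  proof eventually_elim
    case (elim y)
    show ?case
    proof
      assume int: "integrable lborel (\<lambda>x. f x * scalar_kernel \<sigma> t y x)"
      let ?I = "\<integral>x. f x * scalar_kernel \<sigma> t y x \<partial>lborel"
      have "(\<lambda>n. LINT x:{- real n..real n}|lborel. f x * scalar_kernel \<sigma> t y x) \<longlonglongrightarrow> ?I"
        unfolding set_lebesgue_integral_def
      proof (rule integral_dominated_convergence[where w = "\<lambda>x. norm (f x * scalar_kernel \<sigma> t y x)"])
        show "AE x in lborel. (\<lambda>n. indicator {- real n..real n} x *\<^sub>R (f x * scalar_kernel \<sigma> t y x)) \<longlonglongrightarrow>
            f x * scalar_kernel \<sigma> t y x"
        proof (intro AE_I2 tendsto_eventually)
          fix x
          have "eventually (\<lambda>n. real n \<ge> \<bar>x\<bar>) sequentially"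
            using filterlim_real_sequentially by (auto simp: filterlim_at_top)
          then show "\<forall>\<^sub>F n in sequentially. indicator {- real n..real n} x *\<^sub>R (f x * scalar_kernel \<sigma> t y x) =
              f x * scalar_kernel \<sigma> t y x"
            by eventually_elim (auto simp: indicator_def)
        qed
      qed (use int in \<open>auto simp: indicator_def dest: borel_measurable_integrable\<close>)
      then have "(\<lambda>n. u n y) \<longlonglongrightarrow> complex_of_real (exp (- \<sigma> * y\<^sup>2 / 2)) * (scalar_factor \<sigma> t * ?I - g y)"
        unfolding u_def weighted_def scalar_trunc_def by (intro tendsto_intros)
      with elim have "complex_of_real (exp (- \<sigma> * y\<^sup>2 / 2)) * (scalar_factor \<sigma> t * ?I - g y) = 0"
        by blast
      then show "g y = scalar_factor \<sigma> t * ?I"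
        by simp
    qed
  qed
qed

section \<open>Bicomplex functions by idempotent coordinates\<close>

text \<open>A predicate covering both idempotent coordinates, so that each fact about coordinates is
  proved once.\<close>

definition coordinate :: "(bicomplex \<Rightarrow> complex) \<Rightarrow> bool" where
  "coordinate c \<longleftrightarrow> c = cplus \<or> c = cminus"

lemma coordinate_cplus_cminus: "coordinate cplus" "coordinate cminus"
  by (simp_all add: coordinate_def)

lemma all_coordinate: "(\<forall>c. coordinate c \<longrightarrow> P c) \<longleftrightarrow> P cplus \<and> P cminus"
  by (auto simp: coordinate_def)

lemma bicomplex_eqI:
  assumes "\<And>c. coordinate c \<Longrightarrow> c Z = c W"
  shows "Z = W"
  using assms[OF coordinate_cplus_cminus(1)] assms[OF coordinate_cplus_cminus(2)]
  by (metis idem_collapse)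

lemma coordinate_scaleR: "coordinate c \<Longrightarrow> c (r *\<^sub>R Z) = r *\<^sub>R c Z"
  by (auto simp: coordinate_def cplus_def cminus_def algebra_simps)

lemma coordinate_ring:
  assumes "coordinate c"
  shows "c (Z + W) = c Z + c W" "c (Z - W) = c Z - c W" "c (- Z) = - c Z" "c (Z * W) = c Z * c W"
    "c 1 = 1" "c 0 = 0"
  using assms by (auto simp: coordinate_def) (simp_all add: cplus_def cminus_def algebra_simps)

lemma coordinate_of_real: "coordinate c \<Longrightarrow> c (of_real r) = of_real r"
  unfolding of_real_def by (simp add: coordinate_scaleR coordinate_ring)

lemma coordinate_power: "coordinate c \<Longrightarrow> c (Z ^ n) = c Z ^ n"
  by (induction n) (simp_all add: coordinate_ring)

lemma coordinate_divide: "coordinate c \<Longrightarrow> c (Z / W) = c Z / c W"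
  by (simp add: divide_bicomplex_def coordinate_ring divide_inverse)
    (auto simp: coordinate_def inverse_bicomplex_def)

lemma coordinate_functions:
  assumes "coordinate c"
  shows "c (bc_exp Z) = exp (c Z)" "c (bc_sqrt Z) = csqrt (c Z)" "c (bc_star Z) = cnj (c Z)"
  using assms by (auto simp: coordinate_def bc_exp_def bc_sqrt_def bc_star_def)

lemmas coordinate_simps = coordinate_scaleR coordinate_ring coordinate_of_real coordinate_power
  coordinate_divide coordinate_functions

lemma coordinate_bounded_linear:
  assumes "coordinate c"
  shows "bounded_linear c"
proof -
  have "linear c"
    using assms by (intro linearI) (simp_all add: coordinate_simps)
  then show ?thesis
    by (simp add: linear_conv_bounded_linear)
qed

text \<open>A bicomplex number is a bounded linear function of its two coordinates.\<close>

lemma integrable_coordinates: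
  assumes "\<And>c. coordinate c \<Longrightarrow> integrable M (\<lambda>x. c (h x))"
  shows "integrable M h"
proof -
  have "linear (\<lambda>z. idem z 0)" "linear (\<lambda>z. idem 0 z)"
    by (intro linearI bicomplex_eqI; auto simp: coordinate_simps coordinate_def)+
  then have bl: "bounded_linear (\<lambda>z. idem z 0)" "bounded_linear (\<lambda>z. idem 0 z)"
    by (simp_all add: linear_conv_bounded_linear)
  have "integrable M (\<lambda>x. idem (cplus (h x)) 0 + idem 0 (cminus (h x)))"
    by (intro Bochner_Integration.integrable_add integrable_bounded_linear[OF bl(1)]
        integrable_bounded_linear[OF bl(2)] assms coordinate_cplus_cminus)
  moreover have "idem (cplus Z) 0 + idem 0 (cminus Z) = Z" for Z
    by (rule bicomplex_eqI) (auto simp: coordinate_simps coordinate_def)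
  ultimately show ?thesis
    by simp
qed

lemma coordinate_integrable:
  "coordinate c \<Longrightarrow> integrable M h \<Longrightarrow> integrable M (\<lambda>x. c (h x))"
  by (rule integrable_bounded_linear[OF coordinate_bounded_linear])

lemma coordinate_integral:
  "coordinate c \<Longrightarrow> integrable M h \<Longrightarrow> c (\<integral>x. h x \<partial>M) = (\<integral>x. c (h x) \<partial>M)"
  by (rule integral_bounded_linear[OF coordinate_bounded_linear, symmetric])

lemma coordinate_kernel: "coordinate c \<Longrightarrow> c (frft_kernel \<sigma> \<theta> y x) = scalar_kernel \<sigma> (c \<theta>) y x"
  by (simp add: frft_kernel_def scalar_kernel_def coordinate_simps)

lemma coordinate_torus:
  assumes "\<theta> \<in> bc_torus" "(1 - \<theta>\<^sup>2) dvd 1" "coordinate c"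
  shows "cmod (c \<theta>) = 1" "(c \<theta>)\<^sup>2 \<noteq> 1"
proof -
  show "cmod (c \<theta>) = 1"
    using assms by (auto simp: bc_torus_def coordinate_def)
  have "c (1 - \<theta>\<^sup>2) \<noteq> 0"
    using assms unfolding bicomplex_unit_iff by (auto simp: coordinate_def)
  then show "(c \<theta>)\<^sup>2 \<noteq> 1"
    using assms(3) by (simp add: coordinate_simps)
qed

lemma L2_fun_iff: "\<phi> \<in> L2_fun \<sigma> \<longleftrightarrow> (\<forall>c. coordinate c \<longrightarrow> square_integrable (weighted \<sigma> (\<lambda>x. c (\<phi> x))))"
  by (simp add: L2_fun_def sq_integrable_iff all_coordinate)

lemma L2_fun_diff:
  assumes "\<phi> \<in> L2_fun \<sigma>" "\<psi> \<in> L2_fun \<sigma>"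
  shows "(\<lambda>x. \<phi> x - \<psi> x) \<in> L2_fun \<sigma>"
  unfolding L2_fun_iff
proof (intro allI impI)
  fix c
  assume c: "coordinate c"
  then have "weighted \<sigma> (\<lambda>x. c (\<phi> x - \<psi> x)) = (\<lambda>x. weighted \<sigma> (\<lambda>x. c (\<phi> x)) x - weighted \<sigma> (\<lambda>x. c (\<psi> x)) x)"
    by (auto simp: coordinate_simps weighted_diff)
  then show "square_integrable (weighted \<sigma> (\<lambda>x. c (\<phi> x - \<psi> x)))"
    using assms c by (auto simp: L2_fun_iff intro!: square_integrable_diff)
qed

lemma coordinate_trunc:
  assumes "\<theta> \<in> bc_torus" "(1 - \<theta>\<^sup>2) dvd 1" "\<psi> \<in> L2_fun \<sigma>" "coordinate c"
  shows "c (frft_trunc \<sigma> \<theta> \<psi> R y) = scalar_trunc \<sigma> (c \<theta>) (\<lambda>x. c (\<psi> x)) R y"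
proof -
  have "integrable lborel (\<lambda>x. d (indicator {-R..R} x *\<^sub>R (\<psi> x * frft_kernel \<sigma> \<theta> y x)))"
    if d: "coordinate d" for d
    using integrable_scalar_trunc[OF coordinate_torus[OF assms(1,2) d], of \<sigma> "\<lambda>x. d (\<psi> x)"] assms(3) d
    by (simp add: L2_fun_iff coordinate_simps coordinate_kernel)
  then have "integrable lborel (\<lambda>x. indicator {-R..R} x *\<^sub>R (\<psi> x * frft_kernel \<sigma> \<theta> y x))"
    by (rule integrable_coordinates)
  from coordinate_integral[OF assms(4) this] show ?thesis
    using assms(4)
    by (simp add: frft_trunc_def scalar_trunc_def scalar_factor_def set_lebesgue_integral_def coordinate_simps
        coordinate_kernel)
qed

lemma frft_trunc_in_L2_fun:
  assumes "\<theta> \<in> bc_torus" "(1 - \<theta>\<^sup>2) dvd 1" "\<sigma> > 0" "\<psi> \<in> L2_fun \<sigma>"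
  shows "frft_trunc \<sigma> \<theta> \<psi> R \<in> L2_fun \<sigma>"
  unfolding L2_fun_iff
proof (intro allI impI)
  fix c
  assume c: "coordinate c"
  have "(\<lambda>y. c (frft_trunc \<sigma> \<theta> \<psi> R y)) = scalar_trunc \<sigma> (c \<theta>) (\<lambda>x. c (\<psi> x)) R"
    by (intro ext coordinate_trunc assms c)
  then show "square_integrable (weighted \<sigma> (\<lambda>y. c (frft_trunc \<sigma> \<theta> \<psi> R y)))"
    using square_integrable_weighted_scalar_trunc[OF coordinate_torus[OF assms(1,2) c] assms(3)] assms(4) c
    by (simp add: L2_fun_iff)
qed

lemma L2_norm_eq:
  assumes "\<phi> \<in> L2_fun \<sigma>" "\<sigma> > 0"
  shows "L2_norm \<sigma> \<phi> = sqrt (sqrt (\<sigma> / pi) / 2 *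
    ((\<integral>x. (cmod (weighted \<sigma> (\<lambda>x. cplus (\<phi> x)) x))\<^sup>2 \<partial>lborel) +
     (\<integral>x. (cmod (weighted \<sigma> (\<lambda>x. cminus (\<phi> x)) x))\<^sup>2 \<partial>lborel)))"
proof -
  have point: "d (\<phi> x * bc_star (\<phi> x) * of_real (exp (- \<sigma> * x\<^sup>2))) =
      complex_of_real ((cmod (weighted \<sigma> (\<lambda>x. d (\<phi> x)) x))\<^sup>2)" if "coordinate d" for d x
    using that unfolding norm_weighted
    by (simp add: coordinate_simps complex_norm_square[symmetric] del: of_real_exp)
  have sq: "integrable lborel (\<lambda>x. (cmod (weighted \<sigma> (\<lambda>x. d (\<phi> x)) x))\<^sup>2)" if "coordinate d" for d
    using assms that by (intro square_integrable_integrable_sq) (auto simp: L2_fun_iff)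
  have int: "integrable lborel (\<lambda>x. \<phi> x * bc_star (\<phi> x) * of_real (exp (- \<sigma> * x\<^sup>2)))"
    by (rule integrable_coordinates) (simp only: point integrable_of_real sq)
  have "Re (c (L2_inner \<sigma> \<phi> \<phi>)) =
      sqrt (\<sigma> / pi) * (\<integral>x. (cmod (weighted \<sigma> (\<lambda>x. c (\<phi> x)) x))\<^sup>2 \<partial>lborel)" if c: "coordinate c" for c
  proof -
    have "c (LINT x|lborel. \<phi> x * bc_star (\<phi> x) * of_real (exp (- \<sigma> * x\<^sup>2))) =
        complex_of_real (\<integral>x. (cmod (weighted \<sigma> (\<lambda>x. c (\<phi> x)) x))\<^sup>2 \<partial>lborel)"
      unfolding coordinate_integral[OF c int] point[OF c] by (rule integral_complex_of_real)
    then show ?thesis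
      unfolding L2_inner_def coordinate_ring(4)[OF c] coordinate_of_real[OF c] by simp
  qed
  note this[OF coordinate_cplus_cminus(1)] this[OF coordinate_cplus_cminus(2)]
  then show ?thesis
    by (simp add: L2_norm_def algebra_simps add_divide_distrib)
qed

text \<open>The square of the norm is a positive multiple of the sum of the squared norms of the
  coordinates, and a sum of nonnegative terms tends to zero exactly when each term does.\<close>

lemma L2_limit_iff:
  assumes \<sigma>: "\<sigma> > 0" and f: "\<And>R. f R \<in> L2_fun \<sigma>" and g: "g \<in> L2_fun \<sigma>"
  shows "L2_limit \<sigma> f g \<longleftrightarrow> (\<forall>c. coordinate c \<longrightarrow>
    ((\<lambda>R. sqnorm (weighted \<sigma> (\<lambda>x. c (f R x) - c (g x)))) \<longlongrightarrow> 0) at_top)"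
proof -
  define A where "A c R = (\<integral>x. (cmod (weighted \<sigma> (\<lambda>x. c (f R x - g x)) x))\<^sup>2 \<partial>lborel)"
    for c :: "bicomplex \<Rightarrow> complex" and R
  have A_nonneg: "A c R \<ge> 0" for c R
    by (simp add: A_def)
  have fg: "(\<lambda>x. f R x - g x) \<in> L2_fun \<sigma>" for R
    by (intro L2_fun_diff f g)
  have norm_eq: "L2_norm \<sigma> (\<lambda>x. f R x - g x) = sqrt (sqrt (\<sigma> / pi) / 2 * (A cplus R + A cminus R))" for R
    unfolding A_def by (rule L2_norm_eq[OF fg \<sigma>])
  have A_eq: "sqnorm (weighted \<sigma> (\<lambda>x. c (f R x) - c (g x))) = ennreal (A c R)" if "coordinate c" for c R
    unfolding A_def using fg[of R] that
    by (subst sqnorm_eq_integral[symmetric]) (auto simp: L2_fun_iff coordinate_simps)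
  have lim_A: "((\<lambda>R. sqnorm (weighted \<sigma> (\<lambda>x. c (f R x) - c (g x)))) \<longlongrightarrow> 0) at_top \<longleftrightarrow>
      (A c \<longlongrightarrow> 0) at_top" if "coordinate c" for c
    using tendsto_ennreal_iff[of "A c" at_top 0] by (simp add: A_eq[OF that] A_nonneg)
  have k: "sqrt (\<sigma> / pi) / 2 > 0"
    using \<sigma> by simp
  have "((\<lambda>R. L2_norm \<sigma> (\<lambda>x. f R x - g x)) \<longlongrightarrow> 0) at_top \<longleftrightarrow> (A cplus \<longlongrightarrow> 0) at_top \<and> (A cminus \<longlongrightarrow> 0) at_top"
  proof
    assume "((\<lambda>R. L2_norm \<sigma> (\<lambda>x. f R x - g x)) \<longlongrightarrow> 0) at_top"
    then have "((\<lambda>R. (L2_norm \<sigma> (\<lambda>x. f R x - g x))\<^sup>2) \<longlongrightarrow> 0\<^sup>2) at_top"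
      by (rule tendsto_power)
    then have "((\<lambda>R. (L2_norm \<sigma> (\<lambda>x. f R x - g x))\<^sup>2 / (sqrt (\<sigma> / pi) / 2)) \<longlongrightarrow> 0\<^sup>2 / (sqrt (\<sigma> / pi) / 2)) at_top"
      using k by (intro tendsto_divide tendsto_const) auto
    moreover have "(L2_norm \<sigma> (\<lambda>x. f R x - g x))\<^sup>2 / (sqrt (\<sigma> / pi) / 2) = A cplus R + A cminus R" for R
      using k A_nonneg unfolding norm_eq by (subst real_sqrt_pow2) (auto simp: field_simps)
    ultimately have sum: "((\<lambda>R. A cplus R + A cminus R) \<longlongrightarrow> 0) at_top"
      by simp
    have "(A cplus \<longlongrightarrow> 0) at_top"
      by (rule tendsto_sandwich[OF _ _ tendsto_const sum]) (simp_all add: A_nonneg)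
    moreover have "(A cminus \<longlongrightarrow> 0) at_top"
      by (rule tendsto_sandwich[OF _ _ tendsto_const sum]) (simp_all add: A_nonneg)
    ultimately show "(A cplus \<longlongrightarrow> 0) at_top \<and> (A cminus \<longlongrightarrow> 0) at_top" ..
  next
    assume "(A cplus \<longlongrightarrow> 0) at_top \<and> (A cminus \<longlongrightarrow> 0) at_top"
    then have "((\<lambda>R. sqrt (sqrt (\<sigma> / pi) / 2 * (A cplus R + A cminus R))) \<longlongrightarrow>
        sqrt (sqrt (\<sigma> / pi) / 2 * (0 + 0))) at_top"
      by (intro tendsto_intros) auto
    then show "((\<lambda>R. L2_norm \<sigma> (\<lambda>x. f R x - g x)) \<longlongrightarrow> 0) at_top"
      by (simp add: norm_eq)
  qed
  then show ?thesis
    using f g by (simp add: L2_limit_def all_coordinate lim_A coordinate_cplus_cminus)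
qed

lemma L2_limit_frft_iff:
  assumes "\<theta> \<in> bc_torus" "(1 - \<theta>\<^sup>2) dvd 1" "\<sigma> > 0" "\<psi> \<in> L2_fun \<sigma>"
  shows "L2_limit \<sigma> (frft_trunc \<sigma> \<theta> \<psi>) g \<longleftrightarrow>
    (\<forall>c. coordinate c \<longrightarrow> scalar_frft \<sigma> (c \<theta>) (\<lambda>x. c (\<psi> x)) (\<lambda>x. c (g x)))"
proof (cases "g \<in> L2_fun \<sigma>")
  case True
  have "((\<lambda>R. sqnorm (weighted \<sigma> (\<lambda>x. c (frft_trunc \<sigma> \<theta> \<psi> R x) - c (g x)))) \<longlongrightarrow> 0) at_top \<longleftrightarrow>
      scalar_frft \<sigma> (c \<theta>) (\<lambda>x. c (\<psi> x)) (\<lambda>x. c (g x))" if "coordinate c" for c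
    using True assms that by (simp add: coordinate_trunc scalar_frft_def L2_fun_iff)
  then show ?thesis
    using L2_limit_iff[OF assms(3) frft_trunc_in_L2_fun[OF assms] True] by simp
next
  case False
  then have "\<not> L2_limit \<sigma> (frft_trunc \<sigma> \<theta> \<psi>) g"
    by (simp add: L2_limit_def)
  moreover from False have "\<exists>c. coordinate c \<and> \<not> scalar_frft \<sigma> (c \<theta>) (\<lambda>x. c (\<psi> x)) (\<lambda>x. c (g x))"
    unfolding L2_fun_iff scalar_frft_def by blast
  ultimately show ?thesis
    by blast
qed

text \<open>The two coordinates are transformed separately and recombined.\<close>

lemma L2_limit_frft_exists:
  assumes "\<theta> \<in> bc_torus" "(1 - \<theta>\<^sup>2) dvd 1" "\<sigma> > 0" "\<psi> \<in> L2_fun \<sigma>"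
  obtains g where "L2_limit \<sigma> (frft_trunc \<sigma> \<theta> \<psi>) g"
proof -
  have ex: "\<exists>h. scalar_frft \<sigma> (c \<theta>) (\<lambda>x. c (\<psi> x)) h" if "coordinate c" for c
    using scalar_frft_exists[OF coordinate_torus[OF assms(1,2) that] assms(3), of "\<lambda>x. c (\<psi> x)"] assms(4) that
    by (auto simp: L2_fun_iff)
  obtain hp hm where "scalar_frft \<sigma> (cplus \<theta>) (\<lambda>x. cplus (\<psi> x)) hp" "scalar_frft \<sigma> (cminus \<theta>) (\<lambda>x. cminus (\<psi> x)) hm"
    using ex[OF coordinate_cplus_cminus(1)] ex[OF coordinate_cplus_cminus(2)] by blast
  then have "L2_limit \<sigma> (frft_trunc \<sigma> \<theta> \<psi>) (\<lambda>x. idem (hp x) (hm x))"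
    unfolding L2_limit_frft_iff[OF assms] all_coordinate by simp
  with that show thesis .
qed

lemma bc_star_torus:
  assumes "\<theta> \<in> bc_torus" "(1 - \<theta>\<^sup>2) dvd 1"
  shows "bc_star \<theta> \<in> bc_torus" "(1 - (bc_star \<theta>)\<^sup>2) dvd 1" "bc_star (bc_star \<theta>) = \<theta>"
proof -
  show "bc_star \<theta> \<in> bc_torus"
    using assms(1) by (force simp: bc_torus_def bc_star_def)
  have "c (1 - (bc_star \<theta>)\<^sup>2) \<noteq> 0" if "coordinate c" for c
    using coordinate_torus(2)[OF assms that] that
    by (simp add: coordinate_simps flip: complex_cnj_power)
  then show "(1 - (bc_star \<theta>)\<^sup>2) dvd 1"
    unfolding bicomplex_unit_iff by (auto simp: coordinate_def)
  show "bc_star (bc_star \<theta>) = \<theta>"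
    by (rule bicomplex_eqI) (simp add: coordinate_simps)
qed

lemma L2_limit_frft_inversion:
  assumes "\<theta> \<in> bc_torus" "(1 - \<theta>\<^sup>2) dvd 1" "\<sigma> > 0" "\<psi> \<in> L2_fun \<sigma>"
    and g: "L2_limit \<sigma> (frft_trunc \<sigma> \<theta> \<psi>) g"
  shows "L2_limit \<sigma> (frft_trunc \<sigma> (bc_star \<theta>) g) \<psi>"
proof -
  have "g \<in> L2_fun \<sigma>"
    using g by (simp add: L2_limit_def)
  note star = L2_limit_frft_iff[OF bc_star_torus(1,2)[OF assms(1,2)] assms(3) this]
  show ?thesis
    unfolding star
  proof (intro allI impI)
    fix c
    assume c: "coordinate c"
    then have "scalar_frft \<sigma> (c \<theta>) (\<lambda>x. c (\<psi> x)) (\<lambda>x. c (g x))"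
      using g unfolding L2_limit_frft_iff[OF assms(1-4)] by blast
    from scalar_frft_inversion[OF coordinate_torus[OF assms(1,2) c] assms(3) this]
    show "scalar_frft \<sigma> (c (bc_star \<theta>)) (\<lambda>x. c (g x)) (\<lambda>x. c (\<psi> x))"
      using c by (simp add: coordinate_simps)
  qed
qed

lemma L2_class_eq:
  "\<psi> \<in> L2_fun \<sigma> \<Longrightarrow> L2_class \<sigma> \<psi> = {\<phi> \<in> L2_fun \<sigma>. AE x in lborel. \<psi> x = \<phi> x}"
  by (auto simp: L2_class_def L2_rel_def)

lemma L2_space_eq: "L2_space \<sigma> = L2_class \<sigma> ` L2_fun \<sigma>"
  by (auto simp: L2_space_def L2_class_def quotient_def)

lemma AE_coordinates:
  "(AE x in lborel. \<phi> x = \<psi> x) \<longleftrightarrow> (\<forall>c. coordinate c \<longrightarrow> (AE x in lborel. c (\<phi> x) = c (\<psi> x)))"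
proof -
  have "\<phi> x = \<psi> x \<longleftrightarrow> cplus (\<phi> x) = cplus (\<psi> x) \<and> cminus (\<phi> x) = cminus (\<psi> x)" for x
    by (metis idem_collapse)
  then show ?thesis
    by (simp add: all_coordinate)
qed

lemma L2_limit_frft_class:
  assumes "\<theta> \<in> bc_torus" "(1 - \<theta>\<^sup>2) dvd 1" "\<sigma> > 0" "\<psi> \<in> L2_fun \<sigma>"
    and g: "L2_limit \<sigma> (frft_trunc \<sigma> \<theta> \<psi>) g" and h: "h \<in> L2_class \<sigma> g"
  shows "L2_limit \<sigma> (frft_trunc \<sigma> \<theta> \<psi>) h"
  unfolding L2_limit_frft_iff[OF assms(1-4)]
proof (intro allI impI)
  fix c
  assume c: "coordinate c"
  have "g \<in> L2_fun \<sigma>"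
    using g by (simp add: L2_limit_def)
  with h have h': "h \<in> L2_fun \<sigma>" "AE x in lborel. g x = h x"
    by (auto simp: L2_class_eq)
  show "scalar_frft \<sigma> (c \<theta>) (\<lambda>x. c (\<psi> x)) (\<lambda>x. c (h x))"
  proof (rule scalar_frft_cong_AE[OF coordinate_torus[OF assms(1,2) c] assms(3)])
    show "scalar_frft \<sigma> (c \<theta>) (\<lambda>x. c (\<psi> x)) (\<lambda>x. c (g x))"
      using g c unfolding L2_limit_frft_iff[OF assms(1-4)] by blast
  qed (use h' assms(4) c in \<open>auto simp: L2_fun_iff AE_coordinates\<close>)
qed

text \<open>The limit is unique up to null sets and insensitive to changes of the argument on null sets, so
  the set-valued transform takes classes to classes.\<close>

lemma frft_class:
  assumes "\<theta> \<in> bc_torus" "(1 - \<theta>\<^sup>2) dvd 1" "\<sigma> > 0" "\<psi> \<in> L2_fun \<sigma>"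
    and g: "L2_limit \<sigma> (frft_trunc \<sigma> \<theta> \<psi>) g"
  shows "frft \<sigma> \<theta> (L2_class \<sigma> \<psi>) = L2_class \<sigma> g"
proof -
  note tor = coordinate_torus[OF assms(1,2)]
  note iff = L2_limit_frft_iff[OF assms(1-3)]
  have gL: "g \<in> L2_fun \<sigma>"
    using g by (simp add: L2_limit_def)
  show ?thesis
  proof (intro equalityI subsetI)
    fix h
    assume "h \<in> frft \<sigma> \<theta> (L2_class \<sigma> \<psi>)"
    then obtain \<psi>' where \<psi>': "\<psi>' \<in> L2_fun \<sigma>" "AE x in lborel. \<psi> x = \<psi>' x"
      and h: "L2_limit \<sigma> (frft_trunc \<sigma> \<theta> \<psi>') h"
      by (auto simp: frft_def L2_class_eq[OF assms(4)])
    have "AE x in lborel. g x = h x"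
      unfolding AE_coordinates
    proof (intro allI impI)
      fix c
      assume c: "coordinate c"
      show "AE x in lborel. c (g x) = c (h x)"
      proof (rule scalar_frft_unique[OF tor[OF c] assms(3)])
        show "scalar_frft \<sigma> (c \<theta>) (\<lambda>x. c (\<psi> x)) (\<lambda>x. c (g x))"
          using g c unfolding iff[OF assms(4)] by blast
        show "scalar_frft \<sigma> (c \<theta>) (\<lambda>x. c (\<psi>' x)) (\<lambda>x. c (h x))"
          using h c unfolding iff[OF \<psi>'(1)] by blast
        show "AE x in lborel. c (\<psi> x) = c (\<psi>' x)"
          using \<psi>'(2) by eventually_elim simp
      qed
    qed
    with h show "h \<in> L2_class \<sigma> g"
      by (simp add: L2_class_eq[OF gL] L2_limit_def)
  next
    fix h
    assume "h \<in> L2_class \<sigma> g"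
    then have "L2_limit \<sigma> (frft_trunc \<sigma> \<theta> \<psi>) h"
      by (rule L2_limit_frft_class[OF assms])
    moreover have "\<psi> \<in> L2_class \<sigma> \<psi>"
      using assms(4) by (simp add: L2_class_eq)
    ultimately show "h \<in> frft \<sigma> \<theta> (L2_class \<sigma> \<psi>)"
      by (auto simp: frft_def)
  qed
qed

lemma frft_L2_space:
  assumes "\<theta> \<in> bc_torus" "(1 - \<theta>\<^sup>2) dvd 1" "\<sigma> > 0" "\<Psi> \<in> L2_space \<sigma>"
  shows "frft \<sigma> \<theta> \<Psi> \<in> L2_space \<sigma>" "frft \<sigma> (bc_star \<theta>) (frft \<sigma> \<theta> \<Psi>) = \<Psi>"
proof -
  obtain \<psi> where \<psi>: "\<psi> \<in> L2_fun \<sigma>" "\<Psi> = L2_class \<sigma> \<psi>"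
    using assms(4) by (auto simp: L2_space_eq)
  obtain g where g: "L2_limit \<sigma> (frft_trunc \<sigma> \<theta> \<psi>) g"
    by (rule L2_limit_frft_exists[OF assms(1-3) \<psi>(1)])
  then have gL: "g \<in> L2_fun \<sigma>"
    by (simp add: L2_limit_def)
  have eq: "frft \<sigma> \<theta> \<Psi> = L2_class \<sigma> g"
    unfolding \<psi>(2) by (rule frft_class[OF assms(1-3) \<psi>(1) g])
  then show "frft \<sigma> \<theta> \<Psi> \<in> L2_space \<sigma>"
    using gL by (simp add: L2_space_eq)
  show "frft \<sigma> (bc_star \<theta>) (frft \<sigma> \<theta> \<Psi>) = \<Psi>"
    unfolding eq unfolding \<psi>(2)
    by (rule frft_class[OF bc_star_torus(1,2)[OF assms(1,2)] assms(3) gL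
          L2_limit_frft_inversion[OF assms(1-3) \<psi>(1) g]])
qed

lemma L2_limit_frft_pointwise:
  assumes "\<theta> \<in> bc_torus" "(1 - \<theta>\<^sup>2) dvd 1" "\<sigma> > 0" "\<psi> \<in> L2_fun \<sigma>"
    and g: "L2_limit \<sigma> (frft_trunc \<sigma> \<theta> \<psi>) g"
  shows "AE y in lborel. integrable lborel (\<lambda>x. \<psi> x * frft_kernel \<sigma> \<theta> y x) \<longrightarrow>
    g y = of_real (sqrt (\<sigma> / pi)) / bc_sqrt (1 - \<theta>\<^sup>2) * (LINT x|lborel. \<psi> x * frft_kernel \<sigma> \<theta> y x)"
proof -
  let ?P = "\<lambda>c y. integrable lborel (\<lambda>x. c (\<psi> x) * scalar_kernel \<sigma> (c \<theta>) y x) \<longrightarrow>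
      c (g y) = scalar_factor \<sigma> (c \<theta>) * (\<integral>x. c (\<psi> x) * scalar_kernel \<sigma> (c \<theta>) y x \<partial>lborel)"
  have "AE y in lborel. ?P c y" if "coordinate c" for c
    using g that unfolding L2_limit_frft_iff[OF assms(1-4)]
    by (intro scalar_frft_pointwise[OF coordinate_torus[OF assms(1,2) that] assms(3)]) blast
  from this[OF coordinate_cplus_cminus(1)] this[OF coordinate_cplus_cminus(2)]
  have "AE y in lborel. \<forall>c. coordinate c \<longrightarrow> ?P c y"
    unfolding all_coordinate by eventually_elim blast
  then show ?thesis
  proof eventually_elim
    case (elim y)
    show ?case
    proof (intro impI bicomplex_eqI)
      fix c
      assume int: "integrable lborel (\<lambda>x. \<psi> x * frft_kernel \<sigma> \<theta> y x)" and c: "coordinate c"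
      from elim c coordinate_integrable[OF c int]
      show "c (g y) = c (of_real (sqrt (\<sigma> / pi)) / bc_sqrt (1 - \<theta>\<^sup>2) *
          (LINT x|lborel. \<psi> x * frft_kernel \<sigma> \<theta> y x))"
        by (simp add: coordinate_integral[OF c int] coordinate_simps coordinate_kernel scalar_factor_def)
    qed
  qed
qed

theorem corollary6p6:
  fixes \<sigma> :: real and \<theta> :: bicomplex
  assumes "\<sigma> > 0"
    and "\<theta> \<in> bc_torus"
    and "\<theta> \<noteq> 1" "\<theta> \<noteq> - 1" "\<theta> \<noteq> bc_i * bc_j" "\<theta> \<noteq> - (bc_i * bc_j)"
    and "(1 - \<theta>\<^sup>2) dvd 1"
  shows "bij_betw (frft \<sigma> \<theta>) (L2_space \<sigma>) (L2_space \<sigma>) \<and>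
    (\<forall>\<Psi>\<in>L2_space \<sigma>. inv_into (L2_space \<sigma>) (frft \<sigma> \<theta>) \<Psi> = frft \<sigma> (bc_star \<theta>) \<Psi>) \<and>
    (\<forall>\<psi>\<in>L2_fun \<sigma>. \<forall>g\<in>inv_into (L2_space \<sigma>) (frft \<sigma> \<theta>) (L2_class \<sigma> \<psi>).
      L2_limit \<sigma>
        (\<lambda>R x. of_real (sqrt (\<sigma> / pi)) / bc_sqrt (1 - (bc_star \<theta>)\<^sup>2) *
          (LINT y:{-R..R}|lborel. \<psi> y *
            bc_exp (- (of_real \<sigma> / (1 - (bc_star \<theta>)\<^sup>2)) * (of_real y - bc_star \<theta> * of_real x)\<^sup>2)))
        g \<and>
      (AE x in lborel.
        integrable lborel (\<lambda>y. \<psi> y *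
            bc_exp (- (of_real \<sigma> / (1 - (bc_star \<theta>)\<^sup>2)) * (of_real y - bc_star \<theta> * of_real x)\<^sup>2)) \<longrightarrow>
        g x = of_real (sqrt (\<sigma> / pi)) / bc_sqrt (1 - (bc_star \<theta>)\<^sup>2) *
          (LINT y|lborel. \<psi> y *
            bc_exp (- (of_real \<sigma> / (1 - (bc_star \<theta>)\<^sup>2)) * (of_real y - bc_star \<theta> * of_real x)\<^sup>2))))"
proof (intro conjI ballI)
  note tor = assms(2,7,1)
  note tor' = bc_star_torus(1,2)[OF assms(2,7)] assms(1)
  note star_star = bc_star_torus(3)[OF assms(2,7)]
  have left: "frft \<sigma> (bc_star \<theta>) (frft \<sigma> \<theta> \<Psi>) = \<Psi>" if "\<Psi> \<in> L2_space \<sigma>" for \<Psi>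
    by (rule frft_L2_space(2)[OF tor that])
  have right: "frft \<sigma> \<theta> (frft \<sigma> (bc_star \<theta>) \<Psi>) = \<Psi>" if "\<Psi> \<in> L2_space \<sigma>" for \<Psi>
    using frft_L2_space(2)[OF tor' that] unfolding star_star .
  show bij: "bij_betw (frft \<sigma> \<theta>) (L2_space \<sigma>) (L2_space \<sigma>)"
    by (rule bij_betw_byWitness[where f' = "frft \<sigma> (bc_star \<theta>)"])
      (use left right frft_L2_space(1)[OF tor] frft_L2_space(1)[OF tor'] in auto)
  have inv: "inv_into (L2_space \<sigma>) (frft \<sigma> \<theta>) \<Psi> = frft \<sigma> (bc_star \<theta>) \<Psi>" if "\<Psi> \<in> L2_space \<sigma>" for \<Psi>
    by (rule inv_into_f_eq[OF bij_betw_imp_inj_on[OF bij] frft_L2_space(1)[OF tor' that] right[OF that]])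
  then show "inv_into (L2_space \<sigma>) (frft \<sigma> \<theta>) \<Psi> = frft \<sigma> (bc_star \<theta>) \<Psi>" if "\<Psi> \<in> L2_space \<sigma>" for \<Psi>
    using that .
  fix \<psi> g
  assume \<psi>: "\<psi> \<in> L2_fun \<sigma>" and g: "g \<in> inv_into (L2_space \<sigma>) (frft \<sigma> \<theta>) (L2_class \<sigma> \<psi>)"
  have "L2_class \<sigma> \<psi> \<in> L2_space \<sigma>"
    using \<psi> by (simp add: L2_space_eq)
  with g have g_frft: "g \<in> frft \<sigma> (bc_star \<theta>) (L2_class \<sigma> \<psi>)"
    by (simp add: inv)
  obtain h where h: "L2_limit \<sigma> (frft_trunc \<sigma> (bc_star \<theta>) \<psi>) h"
    by (rule L2_limit_frft_exists[OF tor' \<psi>])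
  have "g \<in> L2_class \<sigma> h"
    using g_frft unfolding frft_class[OF tor' \<psi> h] .
  then have lim: "L2_limit \<sigma> (frft_trunc \<sigma> (bc_star \<theta>) \<psi>) g"
    by (rule L2_limit_frft_class[OF tor' \<psi> h])
  then show "L2_limit \<sigma>
        (\<lambda>R x. of_real (sqrt (\<sigma> / pi)) / bc_sqrt (1 - (bc_star \<theta>)\<^sup>2) *
          (LINT y:{-R..R}|lborel. \<psi> y *
            bc_exp (- (of_real \<sigma> / (1 - (bc_star \<theta>)\<^sup>2)) * (of_real y - bc_star \<theta> * of_real x)\<^sup>2)))
        g"
    unfolding frft_trunc_def[abs_def] frft_kernel_def .
  show "AE x in lborel.
        integrable lborel (\<lambda>y. \<psi> y *
            bc_exp (- (of_real \<sigma> / (1 - (bc_star \<theta>)\<^sup>2)) * (of_real y - bc_star \<theta> * of_real x)\<^sup>2)) \<longrightarrow>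
        g x = of_real (sqrt (\<sigma> / pi)) / bc_sqrt (1 - (bc_star \<theta>)\<^sup>2) *
          (LINT y|lborel. \<psi> y *
            bc_exp (- (of_real \<sigma> / (1 - (bc_star \<theta>)\<^sup>2)) * (of_real y - bc_star \<theta> * of_real x)\<^sup>2))"
    using L2_limit_frft_pointwise[OF tor' \<psi> lim] unfolding frft_kernel_def .
qed

end
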